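(* Let $n\ge 1$, let $A$ be an $n\times n$ matrix over $\mathbb{C}$, let $I$ be the $n\times n$ identity matrix, and let $\lambda\in\mathbb{C}$ be an eigenvalue of $A$. Let $P(t)=\det(A-tI)$ be the characteristic polynomial of $A$. Assume that the geometric multiplicity of $\lambda$ equals $k$, where $1\le k\le n-1$. Then the following are equivalent: (i) The algebraic multiplicity of $\lambda$ equals $k$. (ii) For every basis $\mathbf{v}_1,\dots,\mathbf{v}_k$ of $\ker(A-\lambda I)$ there exist $\mathbf{w}_1,\dots,\mathbf{w}_k\in\ker (A-\lambda I)^{\top}$ such that $\mathbf{w}_i^{\top}\mathbf{v}_j=\delta_{ij}$ for all $i,j=1,\dots,k$ and $$\frac{(-1)^kP^{(k)}(\lambda)}{k!}\,\mathbf{v}\mathbf{w}^{\top}=\mathrm{adj}_k(A-\lambda I),$$ where $\mathbf{v}=\mathbf{v}_1\wedge\cdots\wedge\mathbf{v}_k$ and $\mathbf{w}=\mathbf{w}_1\wedge\cdots\wedge\mathbf{w}_k$ are regarded as column vectors in $\mathbb{C}^{\binom{n}{k}}$, and $\mathrm{adj}_k(A-\lambda I)$ is the $k$th adjugate matrix of $A-\lambda I$.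
   Context: The geometric multiplicity of $\lambda$ is $\dim\ker(A-\lambda I)$; the algebraic multiplicity is the multiplicity of $\lambda$ as a root of $P$. $P^{(k)}$ is the $k$th derivative of $P$. The dual space of $\mathbb{C}^n$ is identified with $\mathbb{C}^n$ (column vectors) via the standard dual basis, so a functional $\mathbf{w}$ acts by $\mathbf{w}(\mathbf{x})=\mathbf{w}^{\top}\mathbf{x}$ (plain transpose, no complex conjugation), and the dual map $(A-\lambda I)^*$ is represented by the transpose $(A-\lambda I)^{\top}$. $k$-element subsets of $\{1,\dots,n\}$ are ordered lexicographically (as increasing sequences) and index the coordinates of $\mathbb{C}^{\binom nk}\simeq\bigwedge^k\mathbb{C}^n$. For $\mathbf{x}_1,\dots,\mathbf{x}_k\in\mathbb{C}^n$, the wedge $\mathbf{x}_1\wedge\cdots\wedge\mathbf{x}_k$ is the vector in $\mathbb{C}^{\binom nk}$ whose $S$-coordinate, for $S=\{i_1<\dots<i_k\}$, is the $k\times k$ minor (determinant) of the $n\times k$ matrix $[\mathbf{x}_1\cdots\mathbf{x}_k]$ formed by the rows in $S$. For an $n\times n$ matrix $B$ and $1\le k\le n-1$, the $k$th adjugate $\mathrm{adj}_k B$ is the $\binom nk\times\binom nk$ matrix whose entry in row $S=\{i_1<\dots<i_k\}$ and column $T=\{j_1<\dots<j_k\}$ is $(-1)^{\sum_{l=1}^k(i_l+j_l)}$ times the $(n-k)\times(n-k)$ minor (determinant) of $B$ obtained by deleting the rows $j_1,\dots,j_k$ and the columns $i_1,\dots,i_k$. In particular $\mathrm{adj}_1B$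 is the classical adjugate. *)

theory Defs
  imports
    "Jordan_Normal_Form.Char_Poly"
    "Jordan_Normal_Form.Matrix_Kernel"
    "Jordan_Normal_Form.DL_Submatrix"
begin

text \<open>
  Indices of vectors and matrices start at 0, so subsets of \<open>{1..n}\<close> become subsets of
  \<open>{0..<n}\<close>. In the sign of a \<open>k\<close>-th adjugate the shift changes the exponent by \<open>2 * k\<close>, hence
  does not change the sign.
\<close>

text \<open>
  \<open>subseqs\<close> lists the subsequences containing the head of a list before the others; restricted to
  a fixed length, this enumerates the \<open>k\<close>-subsets of \<open>{0..<n}\<close> in lexicographic order
  (see \<open>ksubsets_lex\<close>).
\<close>

definition ksubsets :: "nat \<Rightarrow> nat \<Rightarrow> nat set list" where
  "ksubsets n k = map set (filter (\<lambda>xs. length xs = k) (subseqs [0..<n]))"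

text \<open>
  \<open>det (A - t I)\<close>; the library's \<open>char_poly\<close> is \<open>det (t I - A)\<close>, which differs by the
  factor \<open>(-1) ^ n\<close>.
\<close>

definition charpoly_minus :: "'a :: comm_ring_1 mat \<Rightarrow> 'a poly" where
  "charpoly_minus A = det (map_mat (\<lambda>a. [:a:]) A - [:0, 1:] \<cdot>\<^sub>m 1\<^sub>m (dim_row A))"

definition wedge :: "nat \<Rightarrow> 'a :: comm_ring_1 vec list \<Rightarrow> 'a vec" where
  "wedge n xs = vec (n choose length xs)
     (\<lambda>s. det (submatrix (mat_of_cols n xs) (ksubsets n (length xs) ! s) {0..<length xs}))"

text \<open>
  The entry in row \<open>S\<close> and column \<open>T\<close> deletes the rows \<open>T\<close> and the columns \<open>S\<close> (transposed, as
  for the classical adjugate).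
\<close>

definition adj_k :: "nat \<Rightarrow> 'a :: comm_ring_1 mat \<Rightarrow> 'a mat" where
  "adj_k k B = (let n = dim_row B in
     mat (n choose k) (n choose k) (\<lambda>(s, t).
       let S = ksubsets n k ! s; T = ksubsets n k ! t
       in (-1) ^ (\<Sum>S + \<Sum>T) * det (submatrix B ({0..<n} - T) ({0..<n} - S))))"


lemma subseqs_subset: "xs \<in> set (subseqs ys) \<Longrightarrow> set xs \<subseteq> set ys"
  using subseqs_powset[of ys] by blast

lemma subseqs_strict_sorted:
  "sorted_wrt (<) (ys :: nat list) \<Longrightarrow> xs \<in> set (subseqs ys) \<Longrightarrow> sorted_wrt (<) xs"
proof (induction ys arbitrary: xs)
  case (Cons y ys)
  then show ?case using subseqs_subset[of _ ys] by (fastforce simp: Let_def)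
qed simp

lemma sorted_list_of_set_subseqs:
  assumes "xs \<in> set (subseqs [0..<n])"
  shows "sorted_list_of_set (set xs) = xs"
proof -
  have "sorted_wrt (<) xs"
    using assms by (rule subseqs_strict_sorted[rotated]) simp
  then show ?thesis
    using sorted_list_of_set.idem_if_sorted_distinct[of xs] strict_sorted_iff[of xs] by blast
qed

lemma subseqs_lex:
  assumes "sorted_wrt (<) (ys :: nat list)"
  shows "sorted_wrt (\<lambda>xs zs. (xs, zs) \<in> lexord {(a, b). a < b})
           (filter (\<lambda>xs. length xs = k) (subseqs ys))"
  using assms
proof (induction ys arbitrary: k)
  case Nil
  then show ?case by simp
next
  case (Cons y ys)
  have gt: "\<forall>x\<in>set zs. y < x" if "zs \<in> set (subseqs ys)" for zs
    using Cons.prems subseqs_subset[OF that] by auto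
  have IH: "sorted_wrt (\<lambda>xs zs. (xs, zs) \<in> lexord {(a, b). a < b})
           (filter (\<lambda>xs. length xs = k) (subseqs ys))" for k
    using Cons by simp
  show ?case
  proof (cases k)
    case 0
    have "filter (\<lambda>xs. length xs = 0) (map ((#) y) (subseqs ys)) = []"
      by (induction "subseqs ys") (auto simp: filter_empty_conv)
    then show ?thesis using IH[of 0] 0 by (simp add: Let_def)
  next
    case (Suc j)
    have "filter (\<lambda>xs. length xs = Suc j) (map ((#) y) (subseqs ys))
        = map ((#) y) (filter (\<lambda>xs. length xs = j) (subseqs ys))"
      by (simp add: filter_map o_def)
    moreover have "(y # xs, zs) \<in> lexord {(a, b). a < b}"
      if "zs \<in> set (subseqs ys)" "length zs = Suc j" for xs zs
      using gt[OF that(1)] that(2) by (cases zs) auto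
    ultimately show ?thesis using IH[of j] IH[of "Suc j"] Suc
      by (auto simp: Let_def sorted_wrt_append sorted_wrt_map)
  qed
qed

lemma ksubsets_lex:
  "sorted_wrt (\<lambda>S T. (sorted_list_of_set S, sorted_list_of_set T) \<in> lexord {(a, b). a < b})
     (ksubsets n k)"
proof -
  have "sorted_wrt (\<lambda>xs zs. (sorted_list_of_set (set xs), sorted_list_of_set (set zs))
            \<in> lexord {(a, b). a < b}) (filter (\<lambda>xs. length xs = k) (subseqs [0..<n]))"
    by (rule sorted_wrt_mono_rel[OF _ subseqs_lex]) (auto simp: sorted_list_of_set_subseqs)
  then show ?thesis by (simp add: ksubsets_def sorted_wrt_map)
qed

lemma set_ksubsets: "set (ksubsets n k) = {S. S \<subseteq> {0..<n} \<and> card S = k}"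
proof -
  have card: "card (set xs) = length xs" if "xs \<in> set (subseqs [0..<n])" for xs
    using subseqs_distinctD[OF that] distinct_card by auto
  have pow: "set ` set (subseqs [0..<n]) = Pow {0..<n}"
    using subseqs_powset[of "[0..<n]"] by simp
  have "set (ksubsets n k) = {S \<in> set ` set (subseqs [0..<n]). card S = k}"
    by (auto simp: ksubsets_def card)
  then show ?thesis unfolding pow by auto
qed

lemma distinct_ksubsets: "distinct (ksubsets n k)"
proof -
  have "(sorted_list_of_set S, sorted_list_of_set S) \<notin> lexord {(a, b). a < (b :: nat)}" for S
    by (rule lexord_irreflexive) simp
  then have "ksubsets n k ! i \<noteq> ksubsets n k ! j"
    if "i < j" "j < length (ksubsets n k)" for i j
    using sorted_wrt_nth_less[OF ksubsets_lex that] by metis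
  then show ?thesis
    by (metis distinct_conv_nth nat_neq_iff)
qed

lemma length_ksubsets: "length (ksubsets n k) = n choose k"
  using distinct_card[OF distinct_ksubsets[of n k]] n_subsets[of "{0..<n}" k]
  by (simp add: set_ksubsets)

end

(*
  Write B = A - l I and complete the kernel basis to an invertible Q = [v_1 ... v_k | U], so that
  Q^{-1} B Q = [0 X; 0 Y]. Then P(l + s) = (-s)^k det (Y - s I), so the algebraic multiplicity is k
  iff det Y is nonzero, and (-1)^k P^(k)(l) / k! = det Y. If det Y is nonzero, U can be chosen such
  that X = 0; the w_i are then the first k rows of Q^{-1}, each minor of B of size n - k factors as
  (minor of Q) * det Y * (minor of Q^{-1}), and Jacobi's complementary minor formula turns the two
  outer factors into the coordinates of the wedges. If det Y = 0, the identity in (ii) would force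
  adj_k B = 0, but B has rank n - k and hence a nonzero minor of that size.
*)
theory Submission
  imports Defs "Jordan_Normal_Form.DL_Rank"
begin

text \<open>In general a minor of a product is a Cauchy-Binet sum over intermediate index sets. Here
  it collapses to one product: the block matrix between \<open>Q\<close> and its inverse has zero
  columns, and in diagonal form also zero rows, at the indices below \<open>k\<close>, so only
  \<open>{k..<n}\<close> contributes. Jacobi's formula replaces a minor on the first
  \<open>k\<close> columns of \<open>Q\<close> by the complementary minor of the inverse with rows
  and columns exchanged, which matches the transposition built into \<open>adj_k\<close>. It is used
  once for each wedge; both uses add the sum of \<open>{0..<k}\<close> to the exponent of the sign,
  so that these sums cancel, and the factors \<open>det Q\<close> and \<open>det R\<close> multiply
  to 1. The block \<open>Y\<close> depends on the completion of the basis, but \<open>det Y\<close>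
  does not, being a coefficient of P up to sign. The nonvanishing of \<open>adj_k\<close> cannot use
  the diagonal form, because \<open>Y\<close> may be singular there; it rests on the rank of the
  last \<open>n - k\<close> columns of \<open>Q * M\<close>, with \<open>M\<close> the triangular
  block matrix.\<close>

section \<open>Jacobi's complementary minor formula\<close>

text \<open>Links the enumeration inside \<open>submatrix\<close> with the sorted lists used for
  permutations. The values of \<open>pick S\<close> below \<open>card S\<close> are strictly
  increasing members of \<open>S\<close>, and there are enough of them to exhaust
  \<open>S\<close>.\<close>

lemma sorted_list_of_set_conv_pick:
  assumes "finite S"
  shows "sorted_list_of_set S = map (pick S) [0..<card S]"
proof -
  have sorted: "sorted_wrt (<) (map (pick S) [0..<card S])"
    by (auto simp: sorted_wrt_iff_nth_less intro: pick_mono_le)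
  have "pick S ` {0..<card S} \<subseteq> S"
    by (auto intro: pick_in_set_le)
  moreover have "inj_on (pick S) {0..<card S}"
    by (auto simp: inj_on_def) (metis nat_neq_iff pick_mono_le)
  ultimately have "pick S ` {0..<card S} = S"
    using assms by (intro card_subset_eq) (auto simp: card_image)
  then show ?thesis
    using sorted assms sorted_list_of_set.idem_if_sorted_distinct[of "map (pick S) [0..<card S]"]
    by (metis atLeast_upt list.set_map strict_sorted_iff atLeast0LessThan)
qed

lemma submatrix_eq_mat:
  assumes "A \<in> carrier_mat m n" "I \<subseteq> {0..<m}" "J \<subseteq> {0..<n}"
  shows "submatrix A I J = mat (card I) (card J) (\<lambda>(i, j). A $$ (pick I i, pick J j))"
proof -
  have "{i. i < m \<and> i \<in> I} = I" "{j. j < n \<and> j \<in> J} = J"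
    using assms by auto
  then show ?thesis using assms(1) unfolding submatrix_def by auto
qed

lemma pick_less:
  assumes "I \<subseteq> {0..<n}" "i < card I"
  shows "pick I i < n"
  using pick_in_set_le[OF assms(2)] assms(1) by auto

lemma pick_atLeastLessThan:
  assumes "i < b - a"
  shows "pick {a..<b} i = a + i"
proof -
  have "pick {a..<b} i = sorted_list_of_set {a..<b} ! i"
    using assms by (subst sorted_list_of_set_conv_pick) auto
  also have "\<dots> = a + i" using assms by simp
  finally show ?thesis .
qed

lemma submatrix_carrier:
  assumes "A \<in> carrier_mat m n" "I \<subseteq> {0..<m}" "J \<subseteq> {0..<n}" "card I = a" "card J = b"
  shows "submatrix A I J \<in> carrier_mat a b"
  using submatrix_eq_mat[OF assms(1-3)] assms(4,5) by simp

text \<open>Replaces Cauchy-Binet: if every term of the product with intermediate index outside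
  \<open>K\<close> vanishes, the sum may be restricted to \<open>K\<close>. For square factors the
  minor is then a single product of minors.\<close>

lemma submatrix_mult:
  assumes A: "A \<in> carrier_mat m p" and B: "B \<in> carrier_mat p n"
    and I: "I \<subseteq> {0..<m}" and J: "J \<subseteq> {0..<n}" and K: "K \<subseteq> {0..<p}"
    and zero: "\<And>i x j. i < m \<Longrightarrow> x < p \<Longrightarrow> x \<notin> K \<Longrightarrow> j < n \<Longrightarrow> A $$ (i, x) * B $$ (x, j) = 0"
  shows "submatrix (A * B) I J = submatrix A I K * submatrix B K J"
proof -
  have finK: "finite K" using K finite_subset by blast
  have bij: "bij_betw (pick K) {0..<card K} K"
  proof -
    have "map (pick K) [0..<card K] = sorted_list_of_set K"
      using sorted_list_of_set_conv_pick[OF finK] by simp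
    then have "set (map (pick K) [0..<card K]) = K" "distinct (map (pick K) [0..<card K])"
      using finK by (metis sorted_list_of_set.set_sorted_key_list_of_set) (metis
          \<open>map (pick K) [0..<card K] = sorted_list_of_set K\<close> sorted_list_of_set.distinct_sorted_key_list_of_set)
    then show ?thesis by (auto simp: bij_betw_def distinct_map)
  qed
  have "(A * B) $$ (i, j) = (\<Sum>x\<in>{0..<card K}. A $$ (i, pick K x) * B $$ (pick K x, j))"
    if "i < m" "j < n" for i j
  proof -
    have "(A * B) $$ (i, j) = (\<Sum>x\<in>{0..<p}. A $$ (i, x) * B $$ (x, j))"
      using that A B by (auto simp: scalar_prod_def)
    also have "\<dots> = (\<Sum>x\<in>K. A $$ (i, x) * B $$ (x, j))"
      using K zero that by (intro sum.mono_neutral_right) auto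
    also have "\<dots> = (\<Sum>x\<in>{0..<card K}. A $$ (i, pick K x) * B $$ (pick K x, j))"
      by (rule sum.reindex_bij_betw[OF bij, symmetric])
    finally show ?thesis .
  qed
  then show ?thesis
    using A B unfolding submatrix_eq_mat[OF A I K] submatrix_eq_mat[OF B K J]
      submatrix_eq_mat[OF mult_carrier_mat[OF A B] I J]
    by (intro eq_matI) (auto simp: scalar_prod_def pick_less[OF I] pick_less[OF J])
qed

section \<open>Permutation matrices of shuffles and their signs\<close>

text \<open>For a list enumerating \<open>{0..<n}\<close> this is a permutation matrix, with the
  unit vector at \<open>xs ! j\<close> as column \<open>j\<close>. Lists are used because an entry
  can simply be dropped from them in an induction on \<open>n\<close>.\<close>

definition sequence_mat :: "nat list \<Rightarrow> 'a :: comm_ring_1 mat" where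
  "sequence_mat xs = mat (length xs) (length xs) (\<lambda>(i, j). if i = xs ! j then 1 else 0)"

text \<open>One-line notation of the permutation that moves \<open>S\<close> to the front and keeps
  the order inside \<open>S\<close> and inside its complement.\<close>

definition shuffle :: "nat \<Rightarrow> nat set \<Rightarrow> nat list" where
  "shuffle n S = sorted_list_of_set S @ sorted_list_of_set ({0..<n} - S)"

lemma sequence_mat_carrier [simp]: "sequence_mat xs \<in> carrier_mat (length xs) (length xs)"
  by (simp add: sequence_mat_def)

lemma length_shuffle:
  assumes "S \<subseteq> {0..<n}"
  shows "length (shuffle n S) = n"
proof -
  have "card S \<le> n" using card_mono[OF _ assms] by simp
  then show ?thesis using finite_subset[OF assms] assms
    by (simp add: shuffle_def card_Diff_subset)
qed

lemma set_shuffle: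
  assumes "S \<subseteq> {0..<n}"
  shows "set (shuffle n S) = {0..<n}"
  using assms finite_subset[OF assms] by (auto simp: shuffle_def)

lemma distinct_shuffle:
  assumes "S \<subseteq> {0..<n}"
  shows "distinct (shuffle n S)"
  using finite_subset[OF assms] by (auto simp: shuffle_def)

lemma shuffle_nth:
  assumes "S \<subseteq> {0..<n}" "i < n"
  shows "shuffle n S ! i = (if i < card S then pick S i else pick ({0..<n} - S) (i - card S))"
proof -
  have fin: "finite S" using finite_subset[OF assms(1)] by simp
  have "card S + card ({0..<n} - S) = n"
    using length_shuffle[OF assms(1)] fin by (simp add: shuffle_def)
  then show ?thesis using assms(2) fin sorted_list_of_set_conv_pick[OF fin]
    sorted_list_of_set_conv_pick[of "{0..<n} - S"] by (auto simp: shuffle_def nth_append)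
qed

text \<open>Laplace expansion along row \<open>n\<close>, whose only nonzero entry is the 1 in
  column \<open>length ys\<close>. Deleting that row and column leaves the matrix of the shortened
  list.\<close>

lemma det_sequence_mat_remove_max:
  assumes "\<forall>x \<in> set ys \<union> set zs. x < n" and n: "length ys + length zs = n"
  shows "det (sequence_mat (ys @ n # zs) :: 'a :: comm_ring_1 mat)
    = (-1) ^ (n + length ys) * det (sequence_mat (ys @ zs))"
proof -
  let ?A = "sequence_mat (ys @ n # zs) :: 'a mat"
  have A: "?A \<in> carrier_mat (Suc n) (Suc n)"
    using sequence_mat_carrier[of "ys @ n # zs"] n by simp
  have row: "?A $$ (n, j) = (if j = length ys then 1 else 0)" if "j < Suc n" for j
  proof -
    have "(ys @ n # zs) ! j < n" if ne: "j \<noteq> length ys"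
    proof (cases "j < length ys")
      case True
      then show ?thesis using assms(1) by (simp add: nth_append)
    next
      case False
      then obtain i where "j = Suc (length ys + i)"
        using ne less_imp_Suc_add[of "length ys" j] by auto
      then show ?thesis using \<open>j < Suc n\<close> n assms(1) by (simp add: nth_append)
    qed
    then show ?thesis using that n
      by (cases "j = length ys") (simp_all add: sequence_mat_def nth_append)
  qed
  have "det ?A = (\<Sum>j<Suc n. ?A $$ (n, j) * cofactor ?A n j)"
    by (rule laplace_expansion_row[OF A]) simp
  also have "\<dots> = (\<Sum>j<Suc n. if j = length ys then cofactor ?A n j else 0)"
    by (rule sum.cong) (auto simp: row)
  also have "\<dots> = cofactor ?A n (length ys)" using n by simp
  also have "mat_delete ?A n (length ys) = sequence_mat (ys @ zs)"
    using n by (intro eq_matI) (auto simp: mat_delete_def sequence_mat_def nth_append Suc_diff_le)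
  then have "cofactor ?A n (length ys) = (-1) ^ (n + length ys) * det (sequence_mat (ys @ zs) :: 'a mat)"
    by (simp add: cofactor_def)
  finally show ?thesis .
qed

text \<open>Induction removing the largest index \<open>n\<close>. Outside \<open>S\<close> it
  stands last and contributes sign 1. Inside \<open>S\<close> it stands at position
  \<open>card T\<close>, where \<open>T = S - {n}\<close>, and contributes the exponent
  \<open>n + card T\<close>: the sum of \<open>S\<close> grows by \<open>n\<close> and the sum of
  \<open>{0..<card S}\<close> by \<open>card T\<close>.\<close>

lemma det_shuffle_mat:
  assumes "S \<subseteq> {0..<n}"
  shows "det (sequence_mat (shuffle n S) :: 'a :: comm_ring_1 mat) = (-1) ^ (\<Sum>S + \<Sum>{0..<card S})"
  using assms
proof (induction n arbitrary: S)
  case 0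
  then show ?case by (simp add: shuffle_def sequence_mat_def det_dim_zero)
next
  case (Suc n)
  have fin: "finite S" using finite_subset[OF Suc.prems] by simp
  have mono: "sorted_list_of_set (insert n T) = sorted_list_of_set T @ [n]"
    if "T \<subseteq> {0..<n}" for T
  proof -
    have "finite T" "n \<notin> T" "\<forall>x\<in>T. x < n" using that finite_subset by auto
    then have "sorted (sorted_list_of_set T @ [n])" "distinct (sorted_list_of_set T @ [n])"
      "set (sorted_list_of_set T @ [n]) = insert n T"
      by (auto simp: sorted_append less_imp_le)
    then show ?thesis by (metis sorted_list_of_set.idem_if_sorted_distinct)
  qed
  show ?case
  proof (cases "n \<in> S")
    case False
    then have S: "S \<subseteq> {0..<n}" using Suc.prems by (auto simp: less_Suc_eq)
    have "{0..<Suc n} - S = insert n ({0..<n} - S)" using False by auto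
    then have "shuffle (Suc n) S = shuffle n S @ n # []"
      using mono[of "{0..<n} - S"] by (simp add: shuffle_def)
    then show ?thesis
      using det_sequence_mat_remove_max[of "shuffle n S" "[]" n, where 'a = 'a] set_shuffle[OF S]
        length_shuffle[OF S] Suc.IH[OF S]
      by simp
  next
    case True
    define T where "T = S - {n}"
    have T: "T \<subseteq> {0..<n}" using Suc.prems by (auto simp: T_def less_Suc_eq)
    have ins: "S = insert n T" "n \<notin> T" "finite T" using True fin by (auto simp: T_def)
    have "{0..<Suc n} - S = {0..<n} - T" using ins T by auto
    then have sh: "shuffle (Suc n) S
        = sorted_list_of_set T @ n # sorted_list_of_set ({0..<n} - T)"
      using mono[OF T] ins by (simp add: shuffle_def)
    have "det (sequence_mat (shuffle (Suc n) S) :: 'a mat)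
        = (-1) ^ (n + card T) * det (sequence_mat (shuffle n T))"
      unfolding sh using T ins(3) length_shuffle[OF T]
      by (subst det_sequence_mat_remove_max) (auto simp: shuffle_def)
    also have "\<dots> = (-1) ^ (n + card T) * (-1) ^ (\<Sum>T + \<Sum>{0..<card T})"
      by (simp add: Suc.IH[OF T])
    finally show ?thesis using ins by (simp add: power_add algebra_simps)
  qed
qed

lemma mult_sequence_mat:
  fixes A :: "'a :: comm_ring_1 mat"
  assumes "A \<in> carrier_mat n n" "length ys = n" "ys \<in> lists {0..<n}"
  shows "A * sequence_mat ys = mat n n (\<lambda>(i, j). A $$ (i, ys ! j))"
proof (rule eq_matI)
  fix i j assume "i < dim_row (mat n n (\<lambda>(i, j). A $$ (i, ys ! j)))"
    "j < dim_col (mat n n (\<lambda>(i, j). A $$ (i, ys ! j)))"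
  then have ij: "i < n" "j < n" by auto
  have "ys ! j < n" using assms(2,3) ij nth_mem[of j ys] by (auto simp: in_lists_conv_set)
  moreover have "(A * sequence_mat ys) $$ (i, j) = (\<Sum>x\<in>{0..<n}. (if x = ys ! j then A $$ (i, x) else 0))"
    using ij assms by (auto simp: scalar_prod_def sequence_mat_def if_distrib[of "\<lambda>c. _ * c"] cong: if_cong)
  ultimately show "(A * sequence_mat ys) $$ (i, j) = mat n n (\<lambda>(i, j). A $$ (i, ys ! j)) $$ (i, j)"
    using ij by simp
qed (use assms in \<open>auto simp: sequence_mat_def\<close>)

lemma transpose_sequence_mat_mult:
  fixes A :: "'a :: comm_ring_1 mat"
  assumes xs: "xs \<in> lists {0..<n}" "length xs = n" and ys: "length ys = n" "ys \<in> lists {0..<n}"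
    and A: "A \<in> carrier_mat n n"
  shows "(sequence_mat xs)\<^sup>T * A * sequence_mat ys = mat n n (\<lambda>(i, j). A $$ (xs ! i, ys ! j))"
proof -
  have P: "sequence_mat xs \<in> carrier_mat n n" using sequence_mat_carrier[of xs] xs(2) by simp
  have AT: "A\<^sup>T \<in> carrier_mat n n" using A by simp
  have lt: "xs ! i < n" "ys ! i < n" if "i < n" for i
    using xs ys that nth_mem[of i xs] nth_mem[of i ys] by (auto simp: in_lists_conv_set)
  have "(sequence_mat xs)\<^sup>T * A = (A\<^sup>T * sequence_mat xs)\<^sup>T"
    using transpose_mult[OF AT P] by simp
  also have "\<dots> = mat n n (\<lambda>(i, j). A $$ (xs ! i, j))"
    unfolding mult_sequence_mat[OF AT xs(2,1)] using A lt by (intro eq_matI) auto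
  finally show ?thesis using mult_sequence_mat[of "mat n n (\<lambda>(i, j). A $$ (xs ! i, j))" n ys] ys lt
    by (intro eq_matI) auto
qed

lemma sequence_mat_shuffle_inverse:
  assumes "S \<subseteq> {0..<n}"
  shows "(sequence_mat (shuffle n S))\<^sup>T * sequence_mat (shuffle n S) = (1\<^sub>m n :: 'a :: comm_ring_1 mat)"
proof -
  note l = length_shuffle[OF assms] and s = set_shuffle[OF assms]
  have m: "shuffle n S \<in> lists {0..<n}" using s by auto
  have lt: "shuffle n S ! i < n" if "i < n" for i
    using nth_mem[of i "shuffle n S"] that l s by auto
  have "(sequence_mat (shuffle n S))\<^sup>T * 1\<^sub>m n * sequence_mat (shuffle n S) = (1\<^sub>m n :: 'a mat)"
    unfolding transpose_sequence_mat_mult[OF m l l m one_carrier_mat]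
    using distinct_shuffle[OF assms] l lt by (auto intro!: eq_matI simp: nth_eq_iff_index_eq)
  moreover have "(sequence_mat (shuffle n S))\<^sup>T \<in> (carrier_mat n n :: 'a mat set)"
    using sequence_mat_carrier[of "shuffle n S"] l by auto
  ultimately show ?thesis by simp
qed

text \<open>Moves an arbitrary minor and its complementary one into diagonal blocks, so that the
  comparison of minors only has to be made for blocks.\<close>

lemma shuffle_conjugate:
  assumes A: "A \<in> carrier_mat n n" and S: "S \<subseteq> {0..<n}" and T: "T \<subseteq> {0..<n}"
    and card: "card S = k" "card T = k"
  shows "(sequence_mat (shuffle n S))\<^sup>T * A * sequence_mat (shuffle n T)
    = four_block_mat (submatrix A S T) (submatrix A S ({0..<n} - T))
        (submatrix A ({0..<n} - S) T) (submatrix A ({0..<n} - S) ({0..<n} - T))"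
proof -
  have m: "shuffle n S \<in> lists {0..<n}" "shuffle n T \<in> lists {0..<n}"
    using set_shuffle[OF S] set_shuffle[OF T] by auto
  have k: "k \<le> n" using card_mono[OF _ S] card by simp
  have c: "card ({0..<n} - S) = n - k" "card ({0..<n} - T) = n - k"
    using S T card by (auto simp: card_Diff_subset finite_subset)
  show ?thesis
    unfolding transpose_sequence_mat_mult[OF m(1) length_shuffle[OF S] length_shuffle[OF T] m(2) A]
    using S T k by (intro eq_matI)
      (auto simp: submatrix_eq_mat[OF A] shuffle_nth[OF S] shuffle_nth[OF T] card c)
qed

section \<open>Minors of an inverse matrix\<close>

text \<open>Multiply by the identity matrix with its second block column replaced by that of the
  inverse. The product has block rows \<open>A, 0\<close> and \<open>C, 1\<close>, and comparing
  determinants gives the claim.\<close>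

lemma det_block_of_inverse:
  fixes A B C D :: "'a :: idom mat"
  assumes A: "A \<in> carrier_mat k k" and B: "B \<in> carrier_mat k m"
    and C: "C \<in> carrier_mat m k" and D: "D \<in> carrier_mat m m"
    and A': "A' \<in> carrier_mat k k" and B': "B' \<in> carrier_mat k m"
    and C': "C' \<in> carrier_mat m k" and D': "D' \<in> carrier_mat m m"
    and inv: "four_block_mat A B C D * four_block_mat A' B' C' D' = 1\<^sub>m (k + m)"
  shows "det A = det (four_block_mat A B C D) * det D'"
proof -
  let ?E = "four_block_mat (A * A' + B * C') (A * B' + B * D') (C * A' + D * C') (C * B' + D * D')"
  have E: "?E = four_block_mat (1\<^sub>m k) (0\<^sub>m k m) (0\<^sub>m m k) (1\<^sub>m m)"
    using inv mult_four_block_mat[OF A B C D A' B' C' D'] by simp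
  \<comment> \<open>Blocks are compared entrywise; the offset \<open>k\<close> in the column index
    reaches the right-hand blocks of the big matrix.\<close>
  have 1: "(A * B' + B * D') = 0\<^sub>m k m"
  proof (rule eq_matI)
    fix i j assume "i < dim_row (0\<^sub>m k m :: 'a mat)" "j < dim_col (0\<^sub>m k m :: 'a mat)"
    then show "(A * B' + B * D') $$ (i, j) = 0\<^sub>m k m $$ (i, j)"
      using arg_cong[OF E, of "\<lambda>M. M $$ (i, k + j)"] A B C D A' B' C' D' by simp
  qed (use A B B' D' in auto)
  have 2: "(C * B' + D * D') = 1\<^sub>m m"
  proof (rule eq_matI)
    fix i j assume "i < dim_row (1\<^sub>m m :: 'a mat)" "j < dim_col (1\<^sub>m m :: 'a mat)"
    then show "(C * B' + D * D') $$ (i, j) = 1\<^sub>m m $$ (i, j)"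
      using arg_cong[OF E, of "\<lambda>M. M $$ (k + i, k + j)"] A B C D A' B' C' D' by simp
  qed (use C D B' D' in auto)
  have "four_block_mat A B C D * four_block_mat (1\<^sub>m k) B' (0\<^sub>m m k) D'
    = four_block_mat A (0\<^sub>m k m) C (1\<^sub>m m)"
    using mult_four_block_mat[OF A B C D one_carrier_mat B' zero_carrier_mat D'] 1 2 A B C D by simp
  then have "det (four_block_mat A B C D * four_block_mat (1\<^sub>m k) B' (0\<^sub>m m k) D') = det A * det (1\<^sub>m m)"
    using det_four_block_mat_upper_right_zero[OF A refl C one_carrier_mat[of m]] by simp
  moreover have "det (four_block_mat A B C D * four_block_mat (1\<^sub>m k) B' (0\<^sub>m m k) D')
    = det (four_block_mat A B C D) * (det (1\<^sub>m k) * det D')"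
    using det_mult[of "four_block_mat A B C D" "k + m" "four_block_mat (1\<^sub>m k) B' (0\<^sub>m m k) D'"]
      det_four_block_mat_lower_left_zero[OF one_carrier_mat B' refl D'] A D D' by simp
  ultimately show ?thesis by simp
qed

text \<open>Permuting the rows of \<open>A\<close> by the shuffle of \<open>S\<close> and its
  columns by that of \<open>T\<close> permutes the inverse the other way round, which is why
  \<open>S\<close> and \<open>T\<close> change places on the right. The sign is the product of the
  two permutation signs.\<close>

lemma jacobi_complementary_minor:
  fixes A B :: "'a :: field mat"
  assumes A: "A \<in> carrier_mat n n" and B: "B \<in> carrier_mat n n" and inv: "A * B = 1\<^sub>m n"
    and S: "S \<subseteq> {0..<n}" and T: "T \<subseteq> {0..<n}" and card: "card S = k" "card T = k"
  shows "det (submatrix A S T)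
    = (-1) ^ (\<Sum>S + \<Sum>T) * det A * det (submatrix B ({0..<n} - T) ({0..<n} - S))"
proof -
  let ?P = "sequence_mat (shuffle n S) :: 'a mat"
  let ?Q = "sequence_mat (shuffle n T) :: 'a mat"
  have P: "?P \<in> carrier_mat n n" "?P\<^sup>T \<in> carrier_mat n n"
    using sequence_mat_carrier[of "shuffle n S"] length_shuffle[OF S] by auto
  have Q: "?Q \<in> carrier_mat n n" "?Q\<^sup>T \<in> carrier_mat n n"
    using sequence_mat_carrier[of "shuffle n T"] length_shuffle[OF T] by auto
  have sgn: "det ?P * det ?Q = (-1) ^ (\<Sum>S + \<Sum>T)"
  proof -
    have "(-1) ^ (\<Sum>S + \<Sum>{0..<k}) * (-1) ^ (\<Sum>T + \<Sum>{0..<k})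
        = (-1) ^ (\<Sum>S + \<Sum>T) * ((-1) ^ \<Sum>{0..<k} * (-1 :: 'a) ^ \<Sum>{0..<k})"
      by (simp add: power_add algebra_simps)
    then show ?thesis using det_shuffle_mat[OF S, where 'a = 'a] det_shuffle_mat[OF T, where 'a = 'a]
      by (simp add: card flip: power_add)
  qed
  have k: "k \<le> n" using card_mono[OF _ S] card by simp
  have c: "card ({0..<n} - S) = n - k" "card ({0..<n} - T) = n - k"
    using S T card by (auto simp: card_Diff_subset finite_subset)
  \<comment> \<open>The product in this order is the one that occurs between \<open>A\<close> and
    \<open>B\<close> below.\<close>
  have QQ: "?Q * ?Q\<^sup>T = 1\<^sub>m n"
    by (rule mat_mult_left_right_inverse[OF Q(2,1) sequence_mat_shuffle_inverse[OF T]])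
  have "(?P\<^sup>T * A * ?Q) * (?Q\<^sup>T * B * ?P) = ?P\<^sup>T * (A * (?Q * ?Q\<^sup>T) * B) * ?P"
    using P Q A B by (simp add: assoc_mult_mat[of _ n n _ n _ n])
  also have "\<dots> = 1\<^sub>m n"
    using P A B inv sequence_mat_shuffle_inverse[OF S, where 'a = 'a] by (simp add: QQ)
  finally have "(?P\<^sup>T * A * ?Q) * (?Q\<^sup>T * B * ?P) = 1\<^sub>m (k + (n - k))" using k by simp
  note inv' = this[unfolded shuffle_conjugate[OF A S T card] shuffle_conjugate[OF B T S card(2,1)]]
  have "det (submatrix A S T) = det (?P\<^sup>T * A * ?Q) * det (submatrix B ({0..<n} - T) ({0..<n} - S))"
    unfolding shuffle_conjugate[OF A S T card]
    by (rule det_block_of_inverse[OF _ _ _ _ _ _ _ _ inv'])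
      (use S T card c in \<open>auto intro!: submatrix_carrier[OF A] submatrix_carrier[OF B]\<close>)
  also have "det (?P\<^sup>T * A * ?Q) = (-1) ^ (\<Sum>S + \<Sum>T) * det A"
    using P Q A by (simp add: det_mult[of _ n] det_transpose[OF P(1)] flip: sgn)
  finally show ?thesis .
qed

section \<open>Kernels and invertible completions\<close>

text \<open>Linear independence of the columns, phrased through the kernel so that repeated columns
  count as dependent; a set of vectors would merge them.\<close>

definition injective_mat :: "'a :: comm_ring_1 mat \<Rightarrow> bool" where
  "injective_mat A \<longleftrightarrow> mat_kernel A = {0\<^sub>v (dim_col A)}"

lemma injective_matD:
  assumes "injective_mat A" "A \<in> carrier_mat n m" "x \<in> carrier_vec m" "A *\<^sub>v x = 0\<^sub>v n"
  shows "x = 0\<^sub>v m"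
  using assms mat_kernelI[of A n m x] by (auto simp: injective_mat_def)

lemma injective_matI:
  assumes "A \<in> carrier_mat n m" "\<And>x. x \<in> carrier_vec m \<Longrightarrow> A *\<^sub>v x = 0\<^sub>v n \<Longrightarrow> x = 0\<^sub>v m"
  shows "injective_mat A"
  using assms by (auto simp: injective_mat_def mat_kernel)

text \<open>Row reduction of the transpose: independence leaves no zero row, so there are
  \<open>m\<close> pivots, and their columns, as rows of \<open>V\<close>, form the required set
  \<open>S\<close>.\<close>

lemma injective_mat_nonzero_minor:
  fixes V :: "'a :: field mat"
  assumes V: "V \<in> carrier_mat n m" and inj: "injective_mat V"
  obtains S where "S \<subseteq> {0..<n}" "card S = m" "det (submatrix V S {0..<m}) \<noteq> 0"
proof -
  define C where "C = gauss_jordan_single V\<^sup>T"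
  have VT: "V\<^sup>T \<in> carrier_mat m n" using V by simp
  from gauss_jordan_single[OF VT C_def[symmetric]] obtain P Q where
    C: "C = P * V\<^sup>T" "C \<in> carrier_mat m n" and ech: "row_echelon_form C"
    and P: "P \<in> carrier_mat m m" and Q: "Q \<in> carrier_mat m m" and PQ: "P * Q = 1\<^sub>m m"
    by auto
  obtain f where f: "pivot_fun C f n" using ech C(2) by (auto simp: row_echelon_form_def)
  have dimC: "dim_row C = m" using C(2) by simp
  note piv = pivot_funD[OF dimC f]
  \<comment> \<open>A zero row of \<open>C\<close> would make the corresponding row of
    \<open>P\<close> a kernel vector of \<open>V\<close>, hence zero, although \<open>P\<close> is
    invertible.\<close>
  have fn: "f i < n" if i: "i < m" for i
  proof (rule ccontr)
    assume "\<not> f i < n"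
    then have "row C i = 0\<^sub>v n"
      using piv(1)[OF i] pivot_fun_zero_row_iff[OF f C(2) i] by simp
    moreover have "V *\<^sub>v row P i = row C i"
      unfolding C(1) using V P i
      by (intro eq_vecI) (auto simp: comm_scalar_prod[of _ m])
    ultimately have "row P i = 0\<^sub>v m"
      using injective_matD[OF inj V, of "row P i"] P i by auto
    moreover have "(P * Q) $$ (i, i) = row P i \<bullet> col Q i" using P Q i by simp
    ultimately show False using PQ Q i by simp
  qed
  have step: "f i < f (Suc i)" if "Suc i < m" for i
    using piv(3)[of i] that fn[of "Suc i"] by simp
  have mono: "f i < f j" if "i < j" "j < m" for i j
    using that
  proof (induction j)
    case (Suc j)
    then show ?case using step[of j] by (cases "i = j") auto
  qed simp
  define S where "S = f ` {0..<m}"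
  have S: "S \<subseteq> {0..<n}" using fn by (auto simp: S_def)
  have inj_f: "inj_on f {0..<m}"
    by (auto simp: inj_on_def) (metis mono nat_neq_iff)
  have card: "card S = m" by (simp add: S_def card_image inj_f)
  have "sorted_wrt (<) (map f [0..<m])"
    by (auto simp: sorted_wrt_iff_nth_less mono)
  then have "sorted_list_of_set S = map f [0..<m]"
    using sorted_list_of_set.idem_if_sorted_distinct[of "map f [0..<m]"]
    by (simp add: strict_sorted_iff S_def)
  then have "map (pick S) [0..<m] = map f [0..<m]"
    using sorted_list_of_set_conv_pick[of S] S finite_subset[of S] card by simp
  then have pick: "pick S i = f i" if "i < m" for i
    using that nth_map[of i "[0..<m]"] by (metis add_0 diff_zero length_upt nth_upt)
  let ?W = "submatrix V S {0..<m}"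
  have W: "?W \<in> carrier_mat m m" using V S card by (auto intro: submatrix_carrier)
  \<comment> \<open>Restricted to its pivot columns, the reduced form \<open>C\<close> is the
    identity; the increasing order of the pivots agrees with that of \<open>pick S\<close>.\<close>
  have "P * ?W\<^sup>T = 1\<^sub>m m"
  proof (rule eq_matI)
    fix i j assume "i < dim_row (1\<^sub>m m :: 'a mat)" "j < dim_col (1\<^sub>m m :: 'a mat)"
    then have ij: "i < m" "j < m" by auto
    have "(P * ?W\<^sup>T) $$ (i, j) = (P * V\<^sup>T) $$ (i, f j)"
      using ij fn[of j] P V W unfolding submatrix_eq_mat[OF V S subset_refl]
      by (auto simp: scalar_prod_def card pick pick_atLeastLessThan)
    also have "\<dots> = (if i = j then 1 else 0)"
      using piv(4)[of i] piv(5)[of j i] fn ij by (auto simp flip: C(1))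
    finally show "(P * ?W\<^sup>T) $$ (i, j) = 1\<^sub>m m $$ (i, j)" using ij by simp
  qed (use P W in auto)
  then have "det P * det ?W = 1"
    using det_mult[of P m "?W\<^sup>T"] P W det_transpose[OF W] by simp
  then have "det ?W \<noteq> 0" by auto
  then show ?thesis using that S card by blast
qed

lemma det_nonzero_imp_inverse:
  fixes A :: "'a :: field mat"
  assumes "A \<in> carrier_mat n n" "det A \<noteq> 0"
  obtains B where "B \<in> carrier_mat n n" "A * B = 1\<^sub>m n" "B * A = 1\<^sub>m n"
  using det_non_zero_imp_unit[OF assms, of "()"] by (auto simp: Units_def ring_mat_def)

text \<open>The columns are completed by the unit vectors at the indices outside the row set
  \<open>S\<close> of a nonzero minor. With the rows in \<open>S\<close> moved to the top, the
  result is block lower triangular with that minor and an identity block on the diagonal.\<close>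

lemma injective_mat_extend:
  fixes V :: "'a :: field mat"
  assumes V: "V \<in> carrier_mat n m" and inj: "injective_mat V"
  obtains Q R where "m \<le> n" "Q \<in> carrier_mat n n" "R \<in> carrier_mat n n" "Q * R = 1\<^sub>m n" "R * Q = 1\<^sub>m n"
    "\<And>i j. i < n \<Longrightarrow> j < m \<Longrightarrow> Q $$ (i, j) = V $$ (i, j)"
proof -
  obtain S where S: "S \<subseteq> {0..<n}" and card: "card S = m" and minor: "det (submatrix V S {0..<m}) \<noteq> 0"
    using injective_mat_nonzero_minor[OF V inj] .
  have m: "m \<le> n" using card_mono[OF _ S] card by simp
  \<comment> \<open>From position \<open>m = card S\<close> on, \<open>shuffle n S\<close> runs
    through the complement of \<open>S\<close>.\<close>
  define Q where "Q = mat n n (\<lambda>(i, j). if j < m then V $$ (i, j)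
    else if i = shuffle n S ! j then 1 else 0)"
  have Q: "Q \<in> carrier_mat n n" by (simp add: Q_def)
  have T: "{0..<m} \<subseteq> {0..<n}" "card {0..<m} = m" "{0..<n} - {0..<m} = {m..<n}" using m by auto
  have S': "{0..<n} - S \<subseteq> {0..<n}" and T': "{m..<n} \<subseteq> {0..<n}" using m by auto
  have cS': "card ({0..<n} - S) = n - m"
    using S card by (auto simp: card_Diff_subset finite_subset)
  have pS: "pick S i < n" "pick S i \<in> S" if "i < m" for i
    using that pick_less[OF S, of i] pick_in_set_le[of i S] card by auto
  have pS': "pick ({0..<n} - S) i < n" "pick ({0..<n} - S) i \<notin> S" if "i < n - m" for i
    using that pick_less[OF S', of i] pick_in_set_le[of i "{0..<n} - S"] cS' by auto
  have inj_pick: "pick ({0..<n} - S) i = pick ({0..<n} - S) j \<longleftrightarrow> i = j"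
    if "i < n - m" "j < n - m" for i j
    using that pick_mono_le[of j "{0..<n} - S" i] pick_mono_le[of i "{0..<n} - S" j] cS'
    by (metis nat_neq_iff)
  have disj: "pick S i \<noteq> pick ({0..<n} - S) j" if "i < m" "j < n - m" for i j
    using pS(2)[OF that(1)] pS'(2)[OF that(2)] by metis
  have 1: "submatrix Q S {0..<m} = submatrix V S {0..<m}"
    unfolding submatrix_eq_mat[OF Q S T(1)] submatrix_eq_mat[OF V S subset_refl] using m
    by (auto intro!: eq_matI simp: Q_def card pS pick_atLeastLessThan)
  have 2: "submatrix Q S {m..<n} = 0\<^sub>m m (n - m)"
    unfolding submatrix_eq_mat[OF Q S T'] using pS m disj
    by (auto intro!: eq_matI simp: Q_def card pick_atLeastLessThan shuffle_nth[OF S])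
  have 3: "submatrix Q ({0..<n} - S) {m..<n} = 1\<^sub>m (n - m)"
    unfolding submatrix_eq_mat[OF Q S' T'] using pS' m
    by (auto intro!: eq_matI simp: Q_def card pick_atLeastLessThan shuffle_nth[OF S] cS' inj_pick)
  let ?P = "sequence_mat (shuffle n S) :: 'a mat"
  \<comment> \<open>This is the identity permutation, present only to bring the product into the
    form of \<open>shuffle_conjugate\<close>.\<close>
  let ?U = "sequence_mat (shuffle n {0..<m}) :: 'a mat"
  have c: "?P \<in> carrier_mat n n" "?P\<^sup>T \<in> carrier_mat n n" "?U \<in> carrier_mat n n"
    using sequence_mat_carrier[of "shuffle n S"] length_shuffle[OF S]
      sequence_mat_carrier[of "shuffle n {0..<m}"] length_shuffle[OF T(1)] by auto
  have "det (?P\<^sup>T * Q * ?U) = det (submatrix V S {0..<m})"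
    unfolding shuffle_conjugate[OF Q S T(1) card T(2)] T(3) 1 2 3
    by (subst det_four_block_mat_upper_right_zero[of _ m _ "n - m"])
      (use m in \<open>auto intro!: submatrix_carrier[OF V S] submatrix_carrier[OF Q S'] simp: card cS'\<close>)
  then have "det Q \<noteq> 0" using minor det_mult[of "?P\<^sup>T" n Q] det_mult[of "?P\<^sup>T * Q" n ?U] c Q by auto
  from det_nonzero_imp_inverse[OF Q this] obtain R where
    "R \<in> carrier_mat n n" "Q * R = 1\<^sub>m n" "R * Q = 1\<^sub>m n" by blast
  moreover have "Q $$ (i, j) = V $$ (i, j)" if "i < n" "j < m" for i j
    using that m by (simp add: Q_def)
  ultimately show ?thesis using that[OF m Q] by blast
qed

section \<open>Coordinates adapted to the kernel\<close>

text \<open>Translates a set-based basis of the kernel into properties of the matrix with these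
  columns; distinctness makes the columns correspond one to one to the basis vectors.\<close>

lemma kernel_basis_matrix:
  fixes B :: "'a :: field mat"
  assumes B: "B \<in> carrier_mat n n" and basis: "kernel.basis n B (set vs)" and dist: "distinct vs"
  shows "set vs \<subseteq> mat_kernel B" "mat_of_cols n vs \<in> carrier_mat n (length vs)"
    "injective_mat (mat_of_cols n vs)"
    "u \<in> mat_kernel B \<Longrightarrow> \<exists>x \<in> carrier_vec (length vs). u = mat_of_cols n vs *\<^sub>v x"
proof -
  interpret kernel n n B by unfold_locales (rule B)
  let ?V = "mat_of_cols n vs"
  show V: "?V \<in> carrier_mat n (length vs)" by simp
  show ker: "set vs \<subseteq> mat_kernel B" using basis by (auto simp: Ker.basis_def)
  then have carrier: "set vs \<subseteq> carrier_vec n" using mat_kernel_carrier[OF B] by blast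
  then have cols: "cols ?V = vs" by simp
  \<comment> \<open>\<open>basis\<close> speaks of independence inside the kernel as a space of its
    own; passing to the ambient space does not affect it.\<close>
  have "NC.lin_indpt (set vs)"
    using basis lindep_same[OF ker] by (auto simp: Ker.basis_def)
  then show "injective_mat ?V"
    using NC.lin_depI[OF V] cols dist by (intro injective_matI[OF V]) metis
  assume u: "u \<in> mat_kernel B"
  have "u \<in> Ker.span (set vs)" using basis u by (auto simp: Ker.basis_def)
  then have "u \<in> NC.span (set vs)" using span_same[OF ker] by simp
  then obtain a where "u = NC.lincomb a (set vs)"
    using NC.finite_in_span[of "set vs" u] carrier by auto
  then have "u = ?V *\<^sub>v vec (length vs) (\<lambda>i. a (col ?V i))"
    using NC.mat_mult_eq_lincomb[OF V] cols dist by simp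
  then show "\<exists>x \<in> carrier_vec (length vs). u = ?V *\<^sub>v x" by (metis vec_carrier)
qed

text \<open>The form shared by both directions of the equivalence: nothing is claimed about the
  invertibility of \<open>Y\<close>.\<close>

lemma kernel_block_form:
  fixes B V :: "'a :: field mat"
  assumes B: "B \<in> carrier_mat n n" and V: "V \<in> carrier_mat n k" and inj: "injective_mat V"
    and BV: "B * V = 0\<^sub>m n k"
  obtains Q R X Y where "k \<le> n" "Q \<in> carrier_mat n n" "R \<in> carrier_mat n n"
    "Q * R = 1\<^sub>m n" "R * Q = 1\<^sub>m n" "X \<in> carrier_mat k (n - k)" "Y \<in> carrier_mat (n - k) (n - k)"
    "\<And>i j. i < n \<Longrightarrow> j < k \<Longrightarrow> Q $$ (i, j) = V $$ (i, j)"
    "B = Q * four_block_mat (0\<^sub>m k k) X (0\<^sub>m (n - k) k) Y * R"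
proof -
  obtain Q R where k: "k \<le> n" and Q: "Q \<in> carrier_mat n n" and R: "R \<in> carrier_mat n n"
    and QR: "Q * R = 1\<^sub>m n" and RQ: "R * Q = 1\<^sub>m n"
    and QV: "\<And>i j. i < n \<Longrightarrow> j < k \<Longrightarrow> Q $$ (i, j) = V $$ (i, j)"
    using injective_mat_extend[OF V inj] by metis
  define M where "M = R * (B * Q)"
  have M: "M \<in> carrier_mat n n" using R B Q by (auto simp: M_def)
  have BQ0: "(B * Q) $$ (i, j) = 0" if "i < n" "j < k" for i j
  proof -
    have "col Q j = col V j" using that k Q V QV by (intro eq_vecI) auto
    then have "(B * Q) $$ (i, j) = (B * V) $$ (i, j)" using that k B Q V by simp
    then show ?thesis using BV that by simp
  qed
  have M0: "M $$ (i, j) = 0" if "i < n" "j < k" for i j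
  proof -
    have "col (B * Q) j = 0\<^sub>v n" using that k B Q BQ0 by (intro eq_vecI) auto
    then show ?thesis using that k B Q R by (simp add: M_def)
  qed
  define X where "X = mat k (n - k) (\<lambda>(i, j). M $$ (i, k + j))"
  define Y where "Y = mat (n - k) (n - k) (\<lambda>(i, j). M $$ (k + i, k + j))"
  have "M = four_block_mat (0\<^sub>m k k) X (0\<^sub>m (n - k) k) Y"
    using M k by (intro eq_matI) (auto simp: X_def Y_def M0)
  moreover have "B = Q * M * R"
  proof -
    have BQ: "B * Q \<in> carrier_mat n n" using B Q by simp
    have "Q * M * R = (Q * R) * (B * Q) * R"
      unfolding M_def using assoc_mult_mat[OF Q R BQ] by simp
    also have "\<dots> = B" unfolding QR left_mult_one_mat[OF BQ] assoc_mult_mat[OF B Q R]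
      using B by simp
    finally show ?thesis by simp
  qed
  ultimately show ?thesis using that[OF k Q R QR RQ, of X Y] QV by (auto simp: X_def Y_def)
qed

text \<open>Conjugation by \<open>N\<close> clears the upper right block \<open>X\<close>, which needs \<open>Y\<close> to be invertible.\<close>

lemma kernel_block_diagonal:
  fixes Q R X Y :: "'a :: field mat"
  assumes k: "k \<le> n" and Q: "Q \<in> carrier_mat n n" and R: "R \<in> carrier_mat n n" and QR: "Q * R = 1\<^sub>m n"
    and X: "X \<in> carrier_mat k (n - k)" and Y: "Y \<in> carrier_mat (n - k) (n - k)" and det: "det Y \<noteq> 0"
    and B: "B = Q * four_block_mat (0\<^sub>m k k) X (0\<^sub>m (n - k) k) Y * R"
  obtains Q' R' where "Q' \<in> carrier_mat n n" "R' \<in> carrier_mat n n" "Q' * R' = 1\<^sub>m n"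
    "\<And>j. j < k \<Longrightarrow> col Q' j = col Q j"
    "B = Q' * four_block_mat (0\<^sub>m k k) (0\<^sub>m k (n - k)) (0\<^sub>m (n - k) k) Y * R'"
proof -
  obtain Z where Z: "Z \<in> carrier_mat (n - k) (n - k)" "Z * Y = 1\<^sub>m (n - k)"
    using det_nonzero_imp_inverse[OF Y det] by metis
  \<comment> \<open>Chosen as \<open>X\<close> times the inverse of \<open>Y\<close>, to solve
    \<open>W * Y = X\<close>.\<close>
  define W where "W = X * Z"
  have W: "W \<in> carrier_mat k (n - k)" unfolding W_def by (rule mult_carrier_mat[OF X Z(1)])
  have WY: "W * Y = X" unfolding W_def using assoc_mult_mat[OF X Z(1) Y] Z(2) X by simp
  let ?N = "four_block_mat (1\<^sub>m k) W (0\<^sub>m (n - k) k) (1\<^sub>m (n - k))"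
  let ?N' = "four_block_mat (1\<^sub>m k) (- W) (0\<^sub>m (n - k) k) (1\<^sub>m (n - k))"
  let ?M = "four_block_mat (0\<^sub>m k k) X (0\<^sub>m (n - k) k) Y"
  let ?D = "four_block_mat (0\<^sub>m k k) (0\<^sub>m k (n - k)) (0\<^sub>m (n - k) k) Y"
  have "?N \<in> carrier_mat (k + (n - k)) (k + (n - k))" "?N' \<in> carrier_mat (k + (n - k)) (k + (n - k))"
    "?D \<in> carrier_mat (k + (n - k)) (k + (n - k))"
    by (rule four_block_carrier_mat; use Y in simp)+
  then have N: "?N \<in> carrier_mat n n" "?N' \<in> carrier_mat n n" "?D \<in> carrier_mat n n"
    using k by auto
  have mW: "- W \<in> carrier_mat k (n - k)" using W by simp
  have neg_zero: "- 0\<^sub>m p q = (0\<^sub>m p q :: 'a mat)" for p q by (intro eq_matI) auto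
  have "?N * ?N' = 1\<^sub>m (k + (n - k))"
    using mult_four_block_mat[OF one_carrier_mat W zero_carrier_mat one_carrier_mat
        one_carrier_mat mW zero_carrier_mat one_carrier_mat] W mW
    by (simp add: uminus_l_inv_mat neg_zero flip: four_block_one_mat)
  then have NN: "?N * ?N' = 1\<^sub>m n" using k by simp
  \<comment> \<open>Left multiplication by \<open>?N\<close> restores \<open>X\<close> as
    \<open>W * Y\<close>; right multiplication by \<open>?N'\<close> changes nothing, because the
    first block column is zero.\<close>
  have MN: "?N * ?D * ?N' = ?M"
  proof -
    have "?N * ?D = ?M"
      using mult_four_block_mat[OF one_carrier_mat W zero_carrier_mat one_carrier_mat
        zero_carrier_mat zero_carrier_mat zero_carrier_mat Y] W X Y WY by simp
    moreover have "?M * ?N' = ?M"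
      using mult_four_block_mat[OF zero_carrier_mat X zero_carrier_mat Y
        one_carrier_mat mW zero_carrier_mat one_carrier_mat] mW X Y by (simp add: neg_zero)
    ultimately show ?thesis by simp
  qed
  show ?thesis
  proof (rule that[of "Q * ?N" "?N' * R"])
    show c: "Q * ?N \<in> carrier_mat n n" "?N' * R \<in> carrier_mat n n" using Q R N by auto
    have "Q * ?N * (?N' * R) = Q * (?N * ?N') * R"
      using Q R N by (simp add: assoc_mult_mat[of _ n n _ n _ n])
    then show "Q * ?N * (?N' * R) = 1\<^sub>m n" using NN Q QR by simp
    have "Q * ?N * ?D * (?N' * R) = Q * (?N * ?D * ?N') * R"
      using Q R N by (simp add: assoc_mult_mat[of _ n n _ n _ n])
    then show "B = Q * ?N * ?D * (?N' * R)" using MN B by simp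
    fix j assume j: "j < k"
    have "col ?N j = unit_vec n j" using j k W by (intro eq_vecI) auto
    then show "col (Q * ?N) j = col Q j"
      using Q N(1) j k by (intro eq_vecI) (simp_all add: scalar_prod_right_unit[of _ n])
  qed
qed

section \<open>The characteristic polynomial at an eigenvalue\<close>

lemma poly_charpoly_minus:
  fixes A :: "'a :: comm_ring_1 mat"
  assumes A: "A \<in> carrier_mat n n"
  shows "poly (charpoly_minus A) t = det (A - t \<cdot>\<^sub>m 1\<^sub>m n)"
  unfolding charpoly_minus_def using A by (intro poly_det_cong[of _ n]) auto

text \<open>Each value agrees up to sign with the value of the monic \<open>char_poly\<close>, which
  cannot vanish at every point of an infinite field.\<close>

lemma charpoly_minus_nonzero:
  fixes A :: "'a :: field_char_0 mat"
  assumes A: "A \<in> carrier_mat n n"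
  shows "charpoly_minus A \<noteq> 0"
proof
  assume 0: "charpoly_minus A = 0"
  have "poly (char_poly A) t = 0" for t
  proof -
    have "poly (char_poly A) t = det (t \<cdot>\<^sub>m 1\<^sub>m n - A)"
      unfolding char_poly_def char_poly_matrix_def using A by (intro poly_det_cong[of _ n]) auto
    also have "t \<cdot>\<^sub>m 1\<^sub>m n - A = (-1) \<cdot>\<^sub>m (A - t \<cdot>\<^sub>m 1\<^sub>m n)"
      using A by (intro eq_matI) auto
    also have "det \<dots> = 0" using poly_charpoly_minus[OF A, of t] 0 by simp
    finally show ?thesis .
  qed
  then show False using degree_monic_char_poly[OF A] poly_all_0_iff_0[of "char_poly A"] by auto
qed

text \<open>One derivative lowers the power of \<open>[:- a, 1:]\<close> by one and replaces
  \<open>r\<close> by a polynomial with value \<open>of_nat (Suc k) * poly r a\<close> at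
  \<open>a\<close>. The induction must therefore leave \<open>r\<close> arbitrary.\<close>

lemma poly_higher_pderiv_at_root_power:
  fixes r :: "'a :: {comm_ring_1, semidom, ring_char_0} poly"
  shows "poly ((pderiv ^^ k) ([:- a, 1:] ^ k * r)) a = fact k * poly r a"
proof (induction k arbitrary: r)
  case (Suc k)
  have "pderiv ([:- a, 1:] ^ Suc k * r)
      = [:- a, 1:] ^ k * (Polynomial.smult (of_nat (Suc k)) r + [:- a, 1:] * pderiv r)"
    by (subst pderiv_mult, subst pderiv_power_Suc) (simp add: pderiv_pCons algebra_simps)
  then show ?case using Suc.IH[of "Polynomial.smult (of_nat (Suc k)) r + [:- a, 1:] * pderiv r"]
    by (simp add: funpow_Suc_right del: funpow.simps)
qed simp

text \<open>Scalar matrices commute with the change of basis, so \<open>A - t I\<close> is conjugate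
  to the block matrix shifted by \<open>t - l\<close>. The identity of values at all
  \<open>t\<close> gives that of the polynomials; \<open>(-1) ^ k\<close> comes from the zero block,
  which contributes \<open>(- (t - l)) ^ k\<close>.\<close>

lemma charpoly_minus_block_triangular:
  fixes A Q R X Y :: "'a :: field_char_0 mat"
  assumes A: "A \<in> carrier_mat n n" and k: "k \<le> n"
    and Q: "Q \<in> carrier_mat n n" and R: "R \<in> carrier_mat n n" and QR: "Q * R = 1\<^sub>m n"
    and X: "X \<in> carrier_mat k (n - k)" and Y: "Y \<in> carrier_mat (n - k) (n - k)"
    and B: "A - l \<cdot>\<^sub>m 1\<^sub>m n = Q * four_block_mat (0\<^sub>m k k) X (0\<^sub>m (n - k) k) Y * R"
  shows "charpoly_minus A
    = [:- l, 1:] ^ k * Polynomial.smult ((- 1) ^ k) (charpoly_minus Y \<circ>\<^sub>p [:- l, 1:])"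
proof -
  let ?M = "four_block_mat (0\<^sub>m k k) X (0\<^sub>m (n - k) k) Y"
  have M: "?M \<in> carrier_mat n n" using four_block_carrier_mat[OF zero_carrier_mat Y, of k k] k by simp
  have "det (A - t \<cdot>\<^sub>m 1\<^sub>m n) = (- (t - l)) ^ k * det (Y - (t - l) \<cdot>\<^sub>m 1\<^sub>m (n - k))" for t
  proof -
    let ?I = "(t - l) \<cdot>\<^sub>m 1\<^sub>m n :: 'a mat"
    have I: "?I \<in> carrier_mat n n" by simp
    have "A - t \<cdot>\<^sub>m 1\<^sub>m n = (A - l \<cdot>\<^sub>m 1\<^sub>m n) - ?I"
      using A by (intro eq_matI) (auto simp: algebra_simps)
    also have "?I = Q * ?I * R"
      using Q R QR mult_smult_distrib[OF Q one_carrier_mat, of "t - l"]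
        mult_smult_assoc_mat[OF Q R, of "t - l"] by simp
    also have "(A - l \<cdot>\<^sub>m 1\<^sub>m n) - Q * ?I * R = Q * (?M - ?I) * R"
      unfolding B mult_minus_distrib_mat[OF Q M I]
      using minus_mult_distrib_mat[OF mult_carrier_mat[OF Q M] mult_carrier_mat[OF Q I] R] by simp
    also have "det \<dots> = det Q * det (?M - ?I) * det R"
    proof -
      have "?M - ?I \<in> carrier_mat n n" by (rule minus_carrier_mat[OF I])
      then show ?thesis using Q R by (simp add: det_mult[of _ n])
    qed
    also have "\<dots> = det (?M - ?I)" using det_mult[OF Q R] QR by (simp add: ac_simps)
    also have "?M - ?I = four_block_mat (- (t - l) \<cdot>\<^sub>m 1\<^sub>m k) X (0\<^sub>m (n - k) k) (Y - (t - l) \<cdot>\<^sub>m 1\<^sub>m (n - k))"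
      using k X Y by (intro eq_matI) auto
    also have "det \<dots> = det (- (t - l) \<cdot>\<^sub>m 1\<^sub>m k) * det (Y - (t - l) \<cdot>\<^sub>m 1\<^sub>m (n - k))"
      by (rule det_four_block_mat_lower_left_zero[OF _ X refl]) (use Y in auto)
    finally show ?thesis by simp
  qed
  then have "poly (charpoly_minus A) t
      = poly ([:- l, 1:] ^ k * Polynomial.smult ((- 1) ^ k) (charpoly_minus Y \<circ>\<^sub>p [:- l, 1:])) t" for t
    by (simp add: poly_charpoly_minus[OF A] poly_charpoly_minus[OF Y] poly_pcompose poly_power
        algebra_simps flip: power_mult_distrib)
  then show ?thesis by (simp add: poly_eq_poly_eq_iff[symmetric] fun_eq_iff)
qed

text \<open>Both claims are read off the cofactor \<open>q\<close> of \<open>[:- l, 1:] ^ k\<close>,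
  whose value at \<open>l\<close> is \<open>(- 1) ^ k * det Y\<close>: the order exceeds
  \<open>k\<close> exactly when this value vanishes, and the derivative is \<open>fact k\<close>
  times it.\<close>

lemma
  fixes A Q R X Y :: "'a :: field_char_0 mat"
  assumes A: "A \<in> carrier_mat n n" and k: "k \<le> n"
    and Q: "Q \<in> carrier_mat n n" and R: "R \<in> carrier_mat n n" and QR: "Q * R = 1\<^sub>m n"
    and X: "X \<in> carrier_mat k (n - k)" and Y: "Y \<in> carrier_mat (n - k) (n - k)"
    and B: "A - l \<cdot>\<^sub>m 1\<^sub>m n = Q * four_block_mat (0\<^sub>m k k) X (0\<^sub>m (n - k) k) Y * R"
  shows order_charpoly_minus_block_triangular:
      "Polynomial.order l (charpoly_minus A) = k \<longleftrightarrow> det Y \<noteq> 0"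
    and higher_pderiv_charpoly_minus_block_triangular:
      "(-1) ^ k * poly ((pderiv ^^ k) (charpoly_minus A)) l / fact k = det Y"
proof -
  define q where "q = Polynomial.smult ((- 1) ^ k) (charpoly_minus Y \<circ>\<^sub>p [:- l, 1:])"
  have P: "charpoly_minus A = [:- l, 1:] ^ k * q"
    unfolding q_def by (rule charpoly_minus_block_triangular[OF assms])
  have "Y - 0 \<cdot>\<^sub>m 1\<^sub>m (n - k) = Y" using Y by (intro eq_matI) auto
  then have q: "poly q l = (- 1) ^ k * det Y"
    by (simp add: q_def poly_pcompose poly_charpoly_minus[OF Y])
  have "charpoly_minus A \<noteq> 0" by (rule charpoly_minus_nonzero[OF A])
  then have nz: "[:- l, 1:] ^ k * q \<noteq> 0" "q \<noteq> 0" using P by auto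
  have "Polynomial.order l (charpoly_minus A) = k + Polynomial.order l q"
    unfolding P order_mult[OF nz(1)] by (simp add: order_power_n_n)
  then show "Polynomial.order l (charpoly_minus A) = k \<longleftrightarrow> det Y \<noteq> 0"
    using order_root[of q l] nz(2) q by auto
  show "(-1) ^ k * poly ((pderiv ^^ k) (charpoly_minus A)) l / fact k = det Y"
    unfolding P poly_higher_pderiv_at_root_power q by (simp flip: power_mult_distrib)
qed

section \<open>Higher adjugates\<close>

lemma adj_k_index:
  assumes "B \<in> carrier_mat n n" "s < n choose k" "t < n choose k"
  shows "adj_k k B $$ (s, t) = (-1) ^ (\<Sum>(ksubsets n k ! s) + \<Sum>(ksubsets n k ! t))
    * det (submatrix B ({0..<n} - ksubsets n k ! t) ({0..<n} - ksubsets n k ! s))"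
  using assms by (simp add: adj_k_def Let_def)

lemma ksubsets_nth:
  assumes "s < n choose k"
  shows "ksubsets n k ! s \<subseteq> {0..<n}" "card (ksubsets n k ! s) = k"
  using nth_mem[of s "ksubsets n k"] assms by (auto simp: set_ksubsets length_ksubsets)

text \<open>The columns \<open>k..<n\<close> of \<open>Q * M\<close> are independent because \<open>Q\<close> is invertible and the kernel
  of \<open>M\<close> is spanned by the first \<open>k\<close> unit vectors, so that some \<open>(n - k)\<close>-minor of them is nonzero.\<close>

lemma adj_k_nonzero:
  fixes B V :: "'a :: field mat"
  assumes B: "B \<in> carrier_mat n n" and V: "V \<in> carrier_mat n k" and inj: "injective_mat V"
    and ker: "\<And>u. u \<in> mat_kernel B \<Longrightarrow> \<exists>x \<in> carrier_vec k. u = V *\<^sub>v x"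
    and BV: "B * V = 0\<^sub>m n k"
  shows "adj_k k B \<noteq> 0\<^sub>m (n choose k) (n choose k)"
proof
  assume zero: "adj_k k B = 0\<^sub>m (n choose k) (n choose k)"
  obtain Q R X Y where k: "k \<le> n" and Q: "Q \<in> carrier_mat n n" and R: "R \<in> carrier_mat n n"
    and QR: "Q * R = 1\<^sub>m n" and RQ: "R * Q = 1\<^sub>m n" and X: "X \<in> carrier_mat k (n - k)"
    and Y: "Y \<in> carrier_mat (n - k) (n - k)"
    and QV: "\<And>i j. i < n \<Longrightarrow> j < k \<Longrightarrow> Q $$ (i, j) = V $$ (i, j)"
    and BQ: "B = Q * four_block_mat (0\<^sub>m k k) X (0\<^sub>m (n - k) k) Y * R"
    using kernel_block_form[OF B V inj BV] by metis
  let ?M = "four_block_mat (0\<^sub>m k k) X (0\<^sub>m (n - k) k) Y"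
  define G where "G = Q * ?M"
  have M: "?M \<in> carrier_mat n n" using four_block_carrier_mat[OF zero_carrier_mat Y, of k k] k by simp
  have G: "G \<in> carrier_mat n n" unfolding G_def by (rule mult_carrier_mat[OF Q M])
  have G0: "G $$ (i, j) = 0" if "i < n" "j < k" for i j
  proof -
    have "col ?M j = 0\<^sub>v n" using that k X Y by (intro eq_vecI) auto
    then show ?thesis using that k Q M by (simp add: G_def)
  qed
  have BG: "B = G * R" unfolding BQ G_def ..
  then have "G = B * Q" using assoc_mult_mat[OF G R Q] RQ G by simp
  define F where "F = mat n (n - k) (\<lambda>(i, j). G $$ (i, k + j))"
  have F: "F \<in> carrier_mat n (n - k)" by (simp add: F_def)
  have "injective_mat F"
  proof (rule injective_matI[OF F])
    fix x assume x: "x \<in> carrier_vec (n - k)" and Fx: "F *\<^sub>v x = 0\<^sub>v n"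
    \<comment> \<open>Padding with \<open>k\<close> leading zeros turns a relation among the columns
      of \<open>F\<close> into one among the columns of \<open>G\<close>, and so gives the kernel
      vector \<open>Q *\<^sub>v ?z\<close> of \<open>B\<close>.\<close>
    let ?z = "0\<^sub>v k @\<^sub>v x"
    have z: "?z \<in> carrier_vec n" using x k append_carrier_vec[of "0\<^sub>v k" k x "n - k"] by simp
    have split: "G = four_block_mat (0\<^sub>m n k) F (0\<^sub>m 0 k) (0\<^sub>m 0 (n - k))"
      using G k G0 by (intro eq_matI) (auto simp: F_def)
    have "G *\<^sub>v ?z = 0\<^sub>v n"
    proof -
      have "G *\<^sub>v ?z = (0\<^sub>m n k *\<^sub>v 0\<^sub>v k + F *\<^sub>v x) @\<^sub>v (0\<^sub>m 0 k *\<^sub>v 0\<^sub>v k + 0\<^sub>m 0 (n - k) *\<^sub>v x)"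
        unfolding split by (rule four_block_mat_mult_vec[OF _ F]) (use x in auto)
      also have "\<dots> = 0\<^sub>v n" using Fx by (intro eq_vecI) auto
      finally show ?thesis .
    qed
    then have "B *\<^sub>v (Q *\<^sub>v ?z) = 0\<^sub>v n"
      using \<open>G = B * Q\<close> assoc_mult_mat_vec[OF B Q z] by simp
    then have "Q *\<^sub>v ?z \<in> mat_kernel B" using mat_kernelI[OF B] Q z by simp
    then obtain y where y: "y \<in> carrier_vec k" and "Q *\<^sub>v ?z = V *\<^sub>v y" using ker by blast
    \<comment> \<open>The kernel vector is also a combination of the first \<open>k\<close> columns
      of \<open>Q\<close>. Its coordinates with respect to \<open>Q\<close> are unique, so those in
      \<open>x\<close> must vanish.\<close>
    define w where "w = y @\<^sub>v 0\<^sub>v (n - k)"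
    have w: "w \<in> carrier_vec n" using y k append_carrier_vec[of y k "0\<^sub>v (n - k)" "n - k"] by (simp add: w_def)
    have "Q *\<^sub>v w = V *\<^sub>v y"
    proof (rule eq_vecI)
      fix i assume i: "i < dim_vec (V *\<^sub>v y)"
      then have "i < n" using V by simp
      have "(Q *\<^sub>v w) $ i = (\<Sum>j\<in>{0..<n}. Q $$ (i, j) * w $ j)"
        using \<open>i < n\<close> Q w by (auto simp: scalar_prod_def)
      also have "\<dots> = (\<Sum>j\<in>{0..<k}. Q $$ (i, j) * w $ j)"
        using k y by (intro sum.mono_neutral_right) (auto simp: w_def)
      also have "\<dots> = (\<Sum>j\<in>{0..<k}. V $$ (i, j) * y $ j)"
        using k y QV \<open>i < n\<close> by (intro sum.cong) (auto simp: w_def)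
      also have "\<dots> = (V *\<^sub>v y) $ i" using \<open>i < n\<close> V y by (auto simp: scalar_prod_def)
      finally show "(Q *\<^sub>v w) $ i = (V *\<^sub>v y) $ i" .
    qed (use Q V in simp)
    then have "R *\<^sub>v (Q *\<^sub>v ?z) = R *\<^sub>v (Q *\<^sub>v w)" using \<open>Q *\<^sub>v ?z = V *\<^sub>v y\<close> by simp
    then have "?z = w"
      using assoc_mult_mat_vec[OF R Q z] assoc_mult_mat_vec[OF R Q w] RQ z w by simp
    show "x = 0\<^sub>v (n - k)"
    proof (rule eq_vecI)
      fix i assume "i < dim_vec (0\<^sub>v (n - k) :: 'a vec)"
      then show "x $ i = 0\<^sub>v (n - k) $ i"
        using arg_cong[OF \<open>?z = w\<close>, of "\<lambda>v. v $ (k + i)"] x y by (simp add: w_def)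
    qed (use x in simp)
  qed
  then obtain T' where T': "T' \<subseteq> {0..<n}" "card T' = n - k" "det (submatrix F T' {0..<n - k}) \<noteq> 0"
    using injective_mat_nonzero_minor[OF F] by blast
  obtain S where S: "S \<subseteq> {0..<n}" "card S = k" "det (submatrix V S {0..<k}) \<noteq> 0"
    using injective_mat_nonzero_minor[OF V inj] by blast
  \<comment> \<open>The entry of \<open>adj_k\<close> in column \<open>T\<close> deletes the rows in
    \<open>T\<close>, so the rows \<open>T'\<close> of the nonzero minor are the ones to be
    kept.\<close>
  define T where "T = {0..<n} - T'"
  have T: "T \<subseteq> {0..<n}" "card T = k" "{0..<n} - T = T'"
    using T' k by (auto simp: T_def card_Diff_subset finite_subset)
  have "S \<in> set (ksubsets n k)" "T \<in> set (ksubsets n k)" using S T by (auto simp: set_ksubsets)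
  then obtain s t where s: "s < n choose k" "ksubsets n k ! s = S"
    and t: "t < n choose k" "ksubsets n k ! t = T"
    unfolding in_set_conv_nth length_ksubsets by blast
  have K: "{0..<k} \<subseteq> {0..<n}" "{k..<n} \<subseteq> {0..<n}" "{0..<n} - {0..<k} = {k..<n}" using k by auto
  have S': "{0..<n} - S \<subseteq> {0..<n}" "card ({0..<n} - S) = n - k"
    using S by (auto simp: card_Diff_subset finite_subset)
  have "submatrix Q S {0..<k} = submatrix V S {0..<k}"
    unfolding submatrix_eq_mat[OF Q S(1) K(1)] submatrix_eq_mat[OF V S(1) subset_refl]
    using S pick_less[OF S(1)] by (auto intro!: eq_matI simp: QV pick_atLeastLessThan)
  \<comment> \<open>Jacobi's formula carries the nonzero minor of \<open>V\<close>, a part of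
    \<open>Q\<close>, over to the complementary minor of \<open>R\<close>.\<close>
  then have Rminor: "det (submatrix R {k..<n} ({0..<n} - S)) \<noteq> 0"
    using jacobi_complementary_minor[OF Q R QR S(1) K(1) S(2)] S(3) unfolding K(3) by auto
  have "submatrix G T' {k..<n} = submatrix F T' {0..<n - k}"
    unfolding submatrix_eq_mat[OF G T'(1) K(2)] submatrix_eq_mat[OF F T'(1) subset_refl]
    using T' pick_less[OF T'(1)] k by (auto intro!: eq_matI simp: F_def pick_atLeastLessThan)
  then have Gminor: "det (submatrix G T' {k..<n}) \<noteq> 0" using T' by simp
  have "submatrix B T' ({0..<n} - S) = submatrix G T' {k..<n} * submatrix R {k..<n} ({0..<n} - S)"
    unfolding BG by (rule submatrix_mult[OF G R T'(1) S'(1) K(2)]) (auto simp: G0)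
  then have "det (submatrix B T' ({0..<n} - S)) \<noteq> 0"
    using Gminor Rminor det_mult[of "submatrix G T' {k..<n}" "n - k" "submatrix R {k..<n} ({0..<n} - S)"]
      submatrix_carrier[OF G T'(1) K(2) T'(2)] submatrix_carrier[OF R K(2) S'(1) _ S'(2)] by simp
  then have "adj_k k B $$ (s, t) \<noteq> 0" using adj_k_index[OF B s(1) t(1)] s(2) t(2) T(3) by simp
  then show False using zero s(1) t(1) by simp
qed

text \<open>The columns kept for row index \<open>S\<close> of the adjugate meet \<open>R\<close> in
  a minor complementary to the rows \<open>S\<close> of \<open>Q\<close>, a coordinate of the wedge
  of \<open>vs\<close>; likewise the column index \<open>T\<close> leads to the wedge of
  \<open>ws\<close>. This fixes the order of the two vectors in the product.\<close>

lemma adj_k_block_diagonal: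
  fixes Q R Y :: "'a :: field mat"
  assumes k: "k \<le> n" and Q: "Q \<in> carrier_mat n n" and R: "R \<in> carrier_mat n n" and QR: "Q * R = 1\<^sub>m n"
    and Y: "Y \<in> carrier_mat (n - k) (n - k)"
    and B: "B = Q * four_block_mat (0\<^sub>m k k) (0\<^sub>m k (n - k)) (0\<^sub>m (n - k) k) Y * R"
    and vs: "length vs = k" "\<And>j. j < k \<Longrightarrow> vs ! j = col Q j"
    and ws: "length ws = k" "\<And>i. i < k \<Longrightarrow> ws ! i = row R i"
  shows "adj_k k B = det Y \<cdot>\<^sub>m
    (mat_of_cols (n choose k) [wedge n vs] * (mat_of_cols (n choose k) [wedge n ws])\<^sup>T)"
proof -
  define D where "D = four_block_mat (0\<^sub>m k k) (0\<^sub>m k (n - k)) (0\<^sub>m (n - k) k) Y"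
  have D: "D \<in> carrier_mat n n"
    using four_block_carrier_mat[OF zero_carrier_mat Y, of k k] k by (simp add: D_def)
  have D0: "D $$ (i, j) = 0" if "i < n" "j < n" "i < k \<or> j < k" for i j
    using that k Y by (auto simp: D_def)
  have QD: "Q * D \<in> carrier_mat n n" by (rule mult_carrier_mat[OF Q D])
  have B_eq: "B = Q * D * R" using B by (simp add: D_def)
  have Bc: "B \<in> carrier_mat n n" unfolding B_eq by (rule mult_carrier_mat[OF QD R])
  have QD0: "(Q * D) $$ (i, j) = 0" if "i < n" "j < k" for i j
  proof -
    have "col D j = 0\<^sub>v n" using that k D D0 by (intro eq_vecI) auto
    then show ?thesis using that k Q D by simp
  qed
  have RQ: "R * Q = 1\<^sub>m n" by (rule mat_mult_left_right_inverse[OF Q R QR])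
  have dets: "det Q * det R = 1" using det_mult[OF Q R] QR by simp
  have K: "{0..<k} \<subseteq> {0..<n}" "{k..<n} \<subseteq> {0..<n}" "{0..<n} - {0..<k} = {k..<n}" using k by auto
  have DY: "submatrix D {k..<n} {k..<n} = Y"
    unfolding submatrix_eq_mat[OF D K(2) K(2)]
    using Y k by (intro eq_matI) (auto simp: D_def pick_atLeastLessThan)
  have wedge_vs: "wedge n vs $ s = (-1) ^ (\<Sum>S + \<Sum>{0..<k}) * det Q * det (submatrix R {k..<n} ({0..<n} - S))"
    if "s < n choose k" "S = ksubsets n k ! s" for s S
  proof -
    have S: "S \<subseteq> {0..<n}" "card S = k" using ksubsets_nth that by auto
    have V: "mat_of_cols n vs \<in> carrier_mat n k" by (metis mat_of_cols_carrier(1) vs(1))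
    have "submatrix (mat_of_cols n vs) S {0..<k} = submatrix Q S {0..<k}"
      unfolding submatrix_eq_mat[OF V S(1) subset_refl] submatrix_eq_mat[OF Q S(1) K(1)]
      using S pick_less[OF S(1)] k Q vs
      by (auto intro!: eq_matI simp: mat_of_cols_index pick_atLeastLessThan)
    then show ?thesis using that vs(1) jacobi_complementary_minor[OF Q R QR S(1) K(1) S(2)] K(3)
      by (simp add: wedge_def)
  qed
  \<comment> \<open>Jacobi's formula with \<open>Q\<close> and \<open>R\<close> exchanged. The
    \<open>ws\<close> are rows of \<open>R\<close> but columns in the wedge, hence the
    transpose.\<close>
  have wedge_ws: "wedge n ws $ t = (-1) ^ (\<Sum>{0..<k} + \<Sum>T) * det R * det (submatrix Q ({0..<n} - T) {k..<n})"
    if "t < n choose k" "T = ksubsets n k ! t" for t T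
  proof -
    have T: "T \<subseteq> {0..<n}" "card T = k" using ksubsets_nth that by auto
    have W: "mat_of_cols n ws \<in> carrier_mat n k" by (metis mat_of_cols_carrier(1) ws(1))
    have "submatrix (mat_of_cols n ws) T {0..<k} = (submatrix R {0..<k} T)\<^sup>T"
      unfolding submatrix_eq_mat[OF W T(1) subset_refl] submatrix_eq_mat[OF R K(1) T(1)]
      using T pick_less[OF T(1)] k R ws
      by (auto intro!: eq_matI simp: mat_of_cols_index pick_atLeastLessThan)
    moreover have "det ((submatrix R {0..<k} T)\<^sup>T) = det (submatrix R {0..<k} T)"
      using T K(1) by (intro det_transpose[of _ k] submatrix_carrier[OF R]) auto
    ultimately show ?thesis using that ws(1) jacobi_complementary_minor[OF R Q RQ K(1) T(1) _ T(2)] K(3)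
      by (simp add: wedge_def)
  qed
  show ?thesis
  proof (rule eq_matI)
    fix s t
    assume "s < dim_row (det Y \<cdot>\<^sub>m (mat_of_cols (n choose k) [wedge n vs] * (mat_of_cols (n choose k) [wedge n ws])\<^sup>T))"
      "t < dim_col (det Y \<cdot>\<^sub>m (mat_of_cols (n choose k) [wedge n vs] * (mat_of_cols (n choose k) [wedge n ws])\<^sup>T))"
    then have st: "s < n choose k" "t < n choose k" by auto
    define S where "S = ksubsets n k ! s"
    define T where "T = ksubsets n k ! t"
    have S: "S \<subseteq> {0..<n}" "card S = k" and T: "T \<subseteq> {0..<n}" "card T = k"
      using ksubsets_nth st by (auto simp: S_def T_def)
    have S': "{0..<n} - S \<subseteq> {0..<n}" "card ({0..<n} - S) = n - k"
      and T': "{0..<n} - T \<subseteq> {0..<n}" "card ({0..<n} - T) = n - k"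
      using S T by (auto simp: card_Diff_subset finite_subset)
    let ?q = "submatrix Q ({0..<n} - T) {k..<n}" and ?r = "submatrix R {k..<n} ({0..<n} - S)"
    have qr: "?q \<in> carrier_mat (n - k) (n - k)" "?r \<in> carrier_mat (n - k) (n - k)"
      using submatrix_carrier[OF Q T'(1) K(2) T'(2)] submatrix_carrier[OF R K(2) S'(1) _ S'(2)] by auto
    have "submatrix B ({0..<n} - T) ({0..<n} - S) = submatrix (Q * D) ({0..<n} - T) {k..<n} * ?r"
      unfolding B_eq by (rule submatrix_mult[OF QD R T'(1) S'(1) K(2)]) (auto simp: QD0)
    also have "submatrix (Q * D) ({0..<n} - T) {k..<n} = ?q * Y"
      unfolding DY[symmetric] by (rule submatrix_mult[OF Q D T'(1) K(2) K(2)]) (auto simp: D0)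
    finally have minor: "det (submatrix B ({0..<n} - T) ({0..<n} - S)) = det ?q * det Y * det ?r"
      using qr Y by (simp add: det_mult[of _ "n - k"])
    have "(mat_of_cols (n choose k) [wedge n vs] * (mat_of_cols (n choose k) [wedge n ws])\<^sup>T) $$ (s, t)
        = wedge n vs $ s * wedge n ws $ t"
      using st by (simp add: scalar_prod_def mat_of_cols_index)
    also have "\<dots> = ((-1) ^ (\<Sum>S + \<Sum>{0..<k}) * (-1) ^ (\<Sum>{0..<k} + \<Sum>T)) * (det Q * det R) * (det ?r * det ?q)"
      unfolding wedge_vs[OF st(1) S_def] wedge_ws[OF st(2) T_def] by (simp add: ac_simps)
    \<comment> \<open>The sum of \<open>{0..<k}\<close> occurs twice in the exponent, which leaves
      the sign of \<open>adj_k\<close>.\<close>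
    also have "(-1 :: 'a) ^ (\<Sum>S + \<Sum>{0..<k}) * (-1) ^ (\<Sum>{0..<k} + \<Sum>T)
        = (-1) ^ (\<Sum>S + \<Sum>T) * ((-1) ^ \<Sum>{0..<k} * (-1) ^ \<Sum>{0..<k})"
      by (simp add: power_add ac_simps)
    also have "\<dots> = (-1) ^ (\<Sum>S + \<Sum>T)" by (simp flip: power_add)
    finally show "adj_k k B $$ (s, t) = (det Y \<cdot>\<^sub>m (mat_of_cols (n choose k) [wedge n vs]
        * (mat_of_cols (n choose k) [wedge n ws])\<^sup>T)) $$ (s, t)"
      using adj_k_index[OF Bc st] minor dets st by (simp add: S_def[symmetric] T_def[symmetric] ac_simps)
  qed (use Bc in \<open>auto simp: adj_k_def Let_def\<close>)
qed

section \<open>The equivalence\<close>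

theorem theorem1p2:
  fixes A :: "complex mat" and l :: complex and n k :: nat
  assumes "n \<ge> 1"
    and "A \<in> carrier_mat n n"
    and "eigenvalue A l"
    and "kernel_dim (A - l \<cdot>\<^sub>m 1\<^sub>m n) = k"
    and "1 \<le> k" and "k \<le> n - 1"
  shows "Polynomial.order l (charpoly_minus A) = k \<longleftrightarrow>
    (\<forall>vs. length vs = k \<and> distinct vs \<and> kernel.basis n (A - l \<cdot>\<^sub>m 1\<^sub>m n) (set vs) \<longrightarrow>
      (\<exists>ws. length ws = k \<and> set ws \<subseteq> mat_kernel ((A - l \<cdot>\<^sub>m 1\<^sub>m n)\<^sup>T) \<and>
        (\<forall>i<k. \<forall>j<k. ws ! i \<bullet> vs ! j = (if i = j then 1 else 0)) \<and>
        ((-1) ^ k * poly ((pderiv ^^ k) (charpoly_minus A)) l / fact k) \<cdot>\<^sub>m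
          (mat_of_cols (n choose k) [wedge n vs] * (mat_of_cols (n choose k) [wedge n ws])\<^sup>T)
        = adj_k k (A - l \<cdot>\<^sub>m 1\<^sub>m n)))"
    (is "?order \<longleftrightarrow> (\<forall>vs. ?basis vs \<longrightarrow> ?dual vs)")
proof -
  define B where "B = A - l \<cdot>\<^sub>m 1\<^sub>m n"
  have B: "B \<in> carrier_mat n n" by (simp add: B_def minus_carrier_mat)
  \<comment> \<open>Stated for an arbitrary basis: one direction is given any basis, the other
    chooses one.\<close>
  have block_form: "\<exists>Q R X Y. k \<le> n \<and> Q \<in> carrier_mat n n \<and> R \<in> carrier_mat n n \<and> Q * R = 1\<^sub>m n \<and>
      X \<in> carrier_mat k (n - k) \<and> Y \<in> carrier_mat (n - k) (n - k) \<and>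
      (\<forall>j<k. col Q j = vs ! j) \<and> B = Q * four_block_mat (0\<^sub>m k k) X (0\<^sub>m (n - k) k) Y * R"
    and nonzero: "adj_k k B \<noteq> 0\<^sub>m (n choose k) (n choose k)"
    if "?basis vs" for vs
  proof -
    let ?V = "mat_of_cols n vs"
    have vs: "length vs = k" "distinct vs" "kernel.basis n B (set vs)" using that by (auto simp: B_def)
    note ker = kernel_basis_matrix[OF B vs(3,2), unfolded vs(1)]
    have carrier: "vs ! j \<in> carrier_vec n" "B *\<^sub>v vs ! j = 0\<^sub>v n" if "j < k" for j
    proof -
      have "vs ! j \<in> mat_kernel B" using ker(1) vs(1) that nth_mem[of j vs] by blast
      then show "vs ! j \<in> carrier_vec n" "B *\<^sub>v vs ! j = 0\<^sub>v n" using mat_kernelD[OF B] by auto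
    qed
    have BV: "B * ?V = 0\<^sub>m n k"
    proof (rule eq_matI)
      fix i j assume "i < dim_row (0\<^sub>m n k :: complex mat)" "j < dim_col (0\<^sub>m n k :: complex mat)"
      then have ij: "i < n" "j < k" by auto
      have "(B * ?V) $$ (i, j) = (B *\<^sub>v vs ! j) $ i"
        using ij B vs(1) carrier(1)[OF ij(2)] by simp
      then show "(B * ?V) $$ (i, j) = 0\<^sub>m n k $$ (i, j)" using ij carrier(2)[OF ij(2)] by simp
    qed (use B vs(1) in auto)
    show "adj_k k B \<noteq> 0\<^sub>m (n choose k) (n choose k)"
      by (rule adj_k_nonzero[OF B ker(2,3) _ BV]) (rule ker(4))
    obtain Q R X Y where dec: "k \<le> n" "Q \<in> carrier_mat n n" "R \<in> carrier_mat n n" "Q * R = 1\<^sub>m n"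
      "X \<in> carrier_mat k (n - k)" "Y \<in> carrier_mat (n - k) (n - k)"
      and QV: "\<And>i j. i < n \<Longrightarrow> j < k \<Longrightarrow> Q $$ (i, j) = ?V $$ (i, j)"
      and BQ: "B = Q * four_block_mat (0\<^sub>m k k) X (0\<^sub>m (n - k) k) Y * R"
      using kernel_block_form[OF B ker(2,3) BV] by metis
    have "col Q j = vs ! j" if "j < k" for j
      using that dec(1,2) carrier(1)[OF that] QV vs(1) by (intro eq_vecI) (auto simp: mat_of_cols_index)
    then show "\<exists>Q R X Y. k \<le> n \<and> Q \<in> carrier_mat n n \<and> R \<in> carrier_mat n n \<and> Q * R = 1\<^sub>m n \<and>
      X \<in> carrier_mat k (n - k) \<and> Y \<in> carrier_mat (n - k) (n - k) \<and>
      (\<forall>j<k. col Q j = vs ! j) \<and> B = Q * four_block_mat (0\<^sub>m k k) X (0\<^sub>m (n - k) k) Y * R"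
      using dec BQ by blast
  qed
  show ?thesis
  proof
    assume order: ?order
    show "\<forall>vs. ?basis vs \<longrightarrow> ?dual vs"
    proof (intro allI impI)
      fix vs assume basis: "?basis vs"
      obtain Q R X Y where k: "k \<le> n" and Q: "Q \<in> carrier_mat n n" and R: "R \<in> carrier_mat n n"
        and QR: "Q * R = 1\<^sub>m n" and X: "X \<in> carrier_mat k (n - k)" and Y: "Y \<in> carrier_mat (n - k) (n - k)"
        and Qvs: "\<And>j. j < k \<Longrightarrow> col Q j = vs ! j"
        and BQ: "B = Q * four_block_mat (0\<^sub>m k k) X (0\<^sub>m (n - k) k) Y * R"
        using block_form[OF basis] by blast
      \<comment> \<open>Clearing \<open>X\<close> leaves \<open>Y\<close> unchanged, so the
        derivative can be taken from this triangular form and the adjugate from the diagonal one,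
        with the same \<open>det Y\<close>.\<close>
      note form = assms(2) k Q R QR X Y BQ[unfolded B_def]
      have "det Y \<noteq> 0" using order order_charpoly_minus_block_triangular[OF form] by simp
      then obtain Q' R' where Q': "Q' \<in> carrier_mat n n" and R': "R' \<in> carrier_mat n n"
        and QR': "Q' * R' = 1\<^sub>m n" and cols: "\<And>j. j < k \<Longrightarrow> col Q' j = col Q j"
        and BQ': "B = Q' * four_block_mat (0\<^sub>m k k) (0\<^sub>m k (n - k)) (0\<^sub>m (n - k) k) Y * R'"
        using kernel_block_diagonal[OF k Q R QR X Y _ BQ] by metis
      have RQ': "R' * Q' = 1\<^sub>m n" by (rule mat_mult_left_right_inverse[OF Q' R' QR'])
      let ?D = "four_block_mat (0\<^sub>m k k) (0\<^sub>m k (n - k)) (0\<^sub>m (n - k) k) Y"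
      have D: "?D \<in> carrier_mat n n" using four_block_carrier_mat[OF zero_carrier_mat Y, of k k] k by simp
      define ws where "ws = map (row R') [0..<k]"
      have len: "length ws = k" and ws: "\<And>i. i < k \<Longrightarrow> ws ! i = row R' i" by (auto simp: ws_def)
      have "R' * B = (R' * Q') * ?D * R'"
        unfolding BQ' using Q' R' D by (simp add: assoc_mult_mat[of _ n n _ n _ n])
      \<comment> \<open>The first \<open>k\<close> rows of \<open>?D\<close> vanish, so the first
        \<open>k\<close> rows of \<open>R'\<close> annihilate \<open>B\<close> from the left, that
        is, they lie in the kernel of the transpose.\<close>
      then have RB: "R' * B = ?D * R'" unfolding RQ' left_mult_one_mat[OF D] .
      have "row R' i \<in> mat_kernel B\<^sup>T" if i: "i < k" for i
      proof (rule mat_kernelI[of _ n n])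
        show "B\<^sup>T *\<^sub>v row R' i = 0\<^sub>v n"
        proof (rule eq_vecI)
          fix j assume "j < dim_vec (0\<^sub>v n :: complex vec)"
          then have j: "j < n" by simp
          have "row ?D i = 0\<^sub>v n" using i k Y by (intro eq_vecI) auto
          then have "(?D * R') $$ (i, j) = 0" using i j k D R' by (simp del: index_mat_four_block(1))
          then have "(R' * B) $$ (i, j) = 0" using RB by simp
          moreover have "row R' i \<in> carrier_vec n" "col B j \<in> carrier_vec n"
            using R' B by (auto intro!: carrier_vecI)
          ultimately show "(B\<^sup>T *\<^sub>v row R' i) $ j = 0\<^sub>v n $ j"
            using i j k B R' comm_scalar_prod[of "row R' i" n "col B j"] by simp
        qed (use B in simp)
      qed (use B R' i k in auto)
      then have "set ws \<subseteq> mat_kernel B\<^sup>T" by (auto simp: ws_def)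
      moreover have "ws ! i \<bullet> vs ! j = (if i = j then 1 else 0)" if "i < k" "j < k" for i j
      proof -
        \<comment> \<open>Duality is the upper left \<open>k\<close> by \<open>k\<close> part of
          \<open>R' * Q' = 1\<close>, since the first columns of \<open>Q'\<close> are still the
          \<open>vs\<close>.\<close>
        have "(R' * Q') $$ (i, j) = row R' i \<bullet> col Q' j" using that k R' Q' by simp
        then show ?thesis using RQ' that k ws cols Qvs by simp
      qed
      moreover have "adj_k k B = det Y \<cdot>\<^sub>m
          (mat_of_cols (n choose k) [wedge n vs] * (mat_of_cols (n choose k) [wedge n ws])\<^sup>T)"
        by (rule adj_k_block_diagonal[OF k Q' R' QR' Y BQ' _ _ len ws]) (use basis cols Qvs in auto)
      ultimately show "?dual vs"
        unfolding higher_pderiv_charpoly_minus_block_triangular[OF form]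
        using len by (auto simp: B_def)
    qed
  next
    assume dual: "\<forall>vs. ?basis vs \<longrightarrow> ?dual vs"
    interpret kernel n n B by unfold_locales (rule B)
    \<comment> \<open>Condition (ii) quantifies over bases, so one has to be exhibited; it has
      \<open>k\<close> members because \<open>k\<close> is the dimension of the kernel.\<close>
    obtain b where b: "finite b" "basis b" using kernel_basis_exists[OF B] by blast
    obtain vs where vs: "set vs = b" "distinct vs" using finite_distinct_list[OF b(1)] by blast
    have "length vs = k"
      using assms(4) kernel_dim Ker.dim_basis[OF b] vs distinct_card[of vs] by (simp add: B_def)
    then have basis: "?basis vs" using vs b by (simp add: B_def)
    obtain Q R X Y where k: "k \<le> n" and Q: "Q \<in> carrier_mat n n" and R: "R \<in> carrier_mat n n"
      and QR: "Q * R = 1\<^sub>m n" and X: "X \<in> carrier_mat k (n - k)" and Y: "Y \<in> carrier_mat (n - k) (n - k)"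
      and BQ: "B = Q * four_block_mat (0\<^sub>m k k) X (0\<^sub>m (n - k) k) Y * R"
      using block_form[OF basis] by blast
    note form = assms(2) k Q R QR X Y BQ[unfolded B_def]
    obtain ws where ws: "((-1) ^ k * poly ((pderiv ^^ k) (charpoly_minus A)) l / fact k) \<cdot>\<^sub>m
          (mat_of_cols (n choose k) [wedge n vs] * (mat_of_cols (n choose k) [wedge n ws])\<^sup>T) = adj_k k B"
      using dual basis unfolding B_def by blast
    have "det Y \<noteq> 0"
    proof
      assume "det Y = 0"
      then have "adj_k k B = 0 \<cdot>\<^sub>m
          (mat_of_cols (n choose k) [wedge n vs] * (mat_of_cols (n choose k) [wedge n ws])\<^sup>T)"
        using ws unfolding higher_pderiv_charpoly_minus_block_triangular[OF form] by simp
      also have "\<dots> = 0\<^sub>m (n choose k) (n choose k)" by (intro eq_matI) auto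
      finally have "adj_k k B = 0\<^sub>m (n choose k) (n choose k)" .
      then show False using nonzero[OF basis] by simp
    qed
    then show ?order using order_charpoly_minus_block_triangular[OF form] by simp
  qed
qed

end
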